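(* Let $d>0$ and let $\Gamma=\{\gamma_{mn}\}_{m,n\in\mathbb{Z}}$ be a $d$-regular sequence of complex numbers. (a) If $d<1$, then $\Gamma$ is not a uniqueness set for the Bargmann-Fock space $\mathcal{F}$. (b) If $d>1$, then $\Gamma$ is a uniqueness set for the Bargmann-Fock space $\mathcal{F}$.
   Context: Write $\lambda_{mn}=m+in$ for $m,n\in\mathbb{Z}$. A sequence $\Gamma=\{\gamma_{mn}\}_{m,n\in\mathbb{Z}}$ of complex numbers is called $d$-regular (with $d>0$ real) if there exist a constant $c>0$ and a function $\phi:[1,\infty)\to\mathbb{R}$ with $\phi(t)/t$ non-increasing and $\int_1^\infty \frac{\phi(t)}{t^2}\,dt<\infty$ such that (i) $|\lambda_{mn}-d\gamma_{mn}|\le \phi(|\lambda_{mn}|)$ for all $(m,n)\neq(0,0)$; and (ii) $|\gamma_{mn}-\gamma_{m'n'}|\ge c\,|\lambda_{mn}-\lambda_{m'n'}|$ for all $m,n,m',n'\in\mathbb{Z}$. The Bargmann-Fock space $\mathcal{F}$ is the space of all entire functions $F$ with $\int_{\mathbb{C}}|F(z)|^2e^{-\pi|z|^2}\,dA(z)<\infty$, where $dA$ is area (Lebesgue) measure on $\mathbb{C}$. A sequence $\Gamma$ in $\mathbb{C}$ is a uniqueness set (uniqueness sequence) for $\mathcal{F}$ if every $F\in\mathcal{F}$ that vanishes at every point of $\Gamma$ is identically zero. *)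

theory Defs
  imports "HOL-Complex_Analysis.Complex_Analysis"
begin

definition lattice_pt :: "int \<Rightarrow> int \<Rightarrow> complex" where
  "lattice_pt m n = Complex (of_int m) (of_int n)"

(* The function phi has domain [1, infinity): only its values there are constrained.
   As phi(t)/t is non-increasing, phi is Borel measurable on that domain, and the closeness
   condition at arbitrarily large lattice points makes phi nonnegative there. So set
   integrability amounts to finiteness of the integral of phi(t)/t^2. *)
definition regular_seq :: "real \<Rightarrow> (int \<Rightarrow> int \<Rightarrow> complex) \<Rightarrow> bool" where
  "regular_seq d \<gamma> \<longleftrightarrow>
     (\<exists>c>0. \<exists>\<phi>::real \<Rightarrow> real.
        antimono_on {1..} (\<lambda>t. \<phi> t / t) \<and>
        set_integrable lborel {1..} (\<lambda>t. \<phi> t / t\<^sup>2) \<and>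
        (\<forall>m n. (m, n) \<noteq> (0, 0) \<longrightarrow>
           cmod (lattice_pt m n - of_real d * \<gamma> m n) \<le> \<phi> (cmod (lattice_pt m n))) \<and>
        (\<forall>m n m' n'.
           cmod (\<gamma> m n - \<gamma> m' n') \<ge> c * cmod (lattice_pt m n - lattice_pt m' n')))"

definition fock_space :: "(complex \<Rightarrow> complex) set" where
  "fock_space =
     {F. F holomorphic_on UNIV \<and>
         integrable lborel (\<lambda>z. (cmod (F z))\<^sup>2 * exp (- pi * (cmod z)\<^sup>2))}"

definition uniqueness_set :: "complex set \<Rightarrow> (complex \<Rightarrow> complex) set \<Rightarrow> bool" where
  "uniqueness_set S X \<longleftrightarrow> (\<forall>F\<in>X. (\<forall>z\<in>S. F z = 0) \<longrightarrow> (\<forall>z. F z = 0))"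

end

(* After rescaling, the points g = d * gamma satisfy |lambda - g| <= a(|lambda|) |lambda| with a
   decreasing and sum a(k)/k finite.

   For d < 1, start from a theta function that vanishes on the lattice and grows like
   exp(pi |z|^2 / 2), and move its zeros from lambda to g one box at a time, multiplying by quotients
   of genus-one Weierstrass factors. On the boundaries of the lattice cells every quotient is
   controlled termwise: lattice points with |lambda| = O(|z|) contribute o(|z|^2) to the logarithm
   because a tends to 0, and the remaining ones contribute at most a constant times
   |z|^2 * sum a(|lambda|)/|lambda|^2, a tail of the convergent sum. The maximum principle transfers
   the bound exp((pi/2 + e) |z|^2) to the cells, and Montel's theorem yields a limit P that vanishes
   at all the points g. Since d < 1, the function P(d z) belongs to the Fock space for small e.

   For d > 1, if F belongs to the Fock space, then F(z/d) is O(exp(pi (|z| + 3d)^2 / (2 d^2))), whereas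
   Jensen's inequality forces a nonzero entire function that vanishes at all the points g to exceed
   exp((pi/2 - e) |z|^2) on large circles. *)
theory Submission
  imports Defs "HOL-Probability.Distributions"
begin

section \<open>A theta function for the Gaussian integers\<close>

text \<open>The critical rate pi / 2 has two sources: theta attains it, and one lattice point per
  unit area forces it through Jensen. Hence every estimate may lose only an arbitrarily small
  multiple of |z|^2.

  For d < 1 the obstacles are the poles of the quotients at the lattice points and the lack of
  smallness of the relative displacement near the origin. Points of index below a threshold
  \<open>K\<close> cost a multiplicative constant; the others are split by comparison with 4 R.
  Below 4 R only an upper bound is available, because a quotient vanishes at its g. Beyond 4 R the
  exponential in the quotient cancels linear terms and gives a two-sided bound. The lower half of it
  keeps the limit away from zero at one auxiliary point.

  For d > 1 the points g must be distinct in order to count as zeros, which is where the separation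
  condition enters. The radial integral in Jensen's formula is replaced by finitely many radii in
  geometric progression.

  Polar coordinates are avoided throughout: the area mean comes from Cauchy's formula on squares,
  and lattice points are counted by covering a disc with unit squares.\<close>

text \<open>The terms of a classical theta series with zeros on the Gaussian integers. The factor \<open>exp (pi * z^2 / 2)\<close> makes the modulus of the sum \<open>O(exp (pi * |z|^2 / 2))\<close>.\<close>

definition theta_term :: "int \<Rightarrow> complex \<Rightarrow> complex" where
  "theta_term n z = (-1) powi n *
     exp (of_real (- pi * (of_int n + 1/2)\<^sup>2) + 2 * of_real pi * \<i> * of_real (of_int n + 1/2) * z + of_real pi * z\<^sup>2 / 2)"

definition theta :: "complex \<Rightarrow> complex" where
  "theta z = (\<Sum>\<^sub>\<infinity>n. theta_term n z)"

text \<open>Completing the square: Re (z^2) / 2 + (Im z)^2 = |z|^2 / 2, so the modulus separates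
  into the growth factor and a Gaussian in n + 1/2 centred at - Im z.\<close>

lemma norm_theta_term:
  "cmod (theta_term n z) = exp (pi * (cmod z)\<^sup>2 / 2) * exp (- pi * (of_int n + 1/2 + Im z)\<^sup>2)"
proof -
  have "cmod ((-1) powi n :: complex) = 1"
    by (simp add: norm_power_int)
  moreover have "Re (of_real (- pi * (of_int n + 1/2)\<^sup>2) + 2 * of_real pi * \<i> * of_real (of_int n + 1/2) * z + of_real pi * z\<^sup>2 / 2)
     = pi * (cmod z)\<^sup>2 / 2 + (- pi * (of_int n + 1/2 + Im z)\<^sup>2)"
    unfolding cmod_power2 by (simp add: power2_eq_square field_simps)
  ultimately show ?thesis
    unfolding theta_term_def norm_mult norm_exp_eq_Re exp_add [symmetric] by simp
qed

lemma exp_neg_abs_summable_int: "(\<lambda>n::int. exp (- \<bar>real_of_int n\<bar>)) summable_on UNIV"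
proof -
  have *: "(\<lambda>n::nat. exp (- real n)) summable_on UNIV"
  proof -
    have "summable (\<lambda>n::nat. exp (-1 :: real) ^ n)"
      by (rule summable_geometric) simp
    then have "summable (\<lambda>n. norm (exp (- real n)))"
      by (simp add: exp_of_nat_mult [symmetric] mult.commute)
    then show ?thesis
      by (rule norm_summable_imp_summable_on)
  qed
  have "(\<lambda>n::int. exp (- \<bar>real_of_int n\<bar>)) summable_on (range int)"
    by (subst summable_on_reindex) (auto simp: o_def * )
  moreover have "(\<lambda>n::int. exp (- \<bar>real_of_int n\<bar>)) summable_on (range (\<lambda>n. - int n))"
    by (subst summable_on_reindex) (auto simp: o_def * inj_on_def)
  ultimately have "(\<lambda>n::int. exp (- \<bar>real_of_int n\<bar>)) summable_on (range int \<union> range (\<lambda>n. - int n))"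
    by (rule summable_on_union)
  moreover have "range int \<union> range (\<lambda>n. - int n) = UNIV"
  proof -
    have "x \<in> range int \<union> range (\<lambda>n. - int n)" for x
      by (cases x rule: int_cases2) auto
    then show ?thesis by blast
  qed
  ultimately show ?thesis by simp
qed

text \<open>From |t| \<le> t^2 + 1 and pi > 1. Gaussians with bounded centres thus share one
  summable majorant, as local uniform convergence requires.\<close>

lemma gaussian_le_exp_neg_abs:
  fixes x c :: real
  shows "exp (- pi * (x + c)\<^sup>2) \<le> exp (\<bar>c\<bar> + 1) * exp (- \<bar>x\<bar>)"
proof -
  have "\<bar>x + c\<bar> \<le> (x + c)\<^sup>2 + 1"
    using zero_le_power2[of "\<bar>x+c\<bar> - 1/2"] by (simp add: power2_eq_square algebra_simps)
  moreover have "(x + c)\<^sup>2 \<le> pi * (x + c)\<^sup>2"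
    using pi_gt3 by (simp add: mult_le_cancel_right1)
  ultimately have "- pi * (x + c)\<^sup>2 \<le> \<bar>c\<bar> + 1 + (- \<bar>x\<bar>)"
    by linarith
  then show ?thesis unfolding exp_add [symmetric] by (rule iffD2 [OF exp_le_cancel_iff])
qed

lemma norm_theta_term_le:
  assumes "cmod z \<le> \<rho>"
  shows "cmod (theta_term n z) \<le> exp (pi * \<rho>\<^sup>2 / 2) * (exp (\<rho> + 2) * exp (- \<bar>real_of_int n\<bar>))"
proof -
  have "exp (- pi * (of_int n + 1/2 + Im z)\<^sup>2) \<le> exp (\<bar>1/2 + Im z\<bar> + 1) * exp (- \<bar>real_of_int n\<bar>)"
    using gaussian_le_exp_neg_abs[of "of_int n" "1/2 + Im z"] by (simp add: add_ac)
  also have "\<dots> \<le> exp (\<rho> + 2) * exp (- \<bar>real_of_int n\<bar>)"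
    using abs_Im_le_cmod[of z] assms by (intro mult_right_mono) auto
  finally show ?thesis
    unfolding norm_theta_term using assms by (intro mult_mono) (auto intro!: power_mono)
qed

lemma theta_term_summable: "(\<lambda>n. theta_term n z) summable_on UNIV"
proof -
  have "(\<lambda>n. norm (theta_term n z)) summable_on UNIV"
    by (rule Infinite_Sum.summable_on_comparison_test [OF summable_on_cmult_right [OF summable_on_cmult_right [OF exp_neg_abs_summable_int]]])
       (use norm_theta_term_le[OF order_refl] in auto)
  then show ?thesis by (rule abs_summable_summable)
qed

lemma theta_holomorphic: "theta holomorphic_on UNIV"
proof -
  have "theta holomorphic_on ball 0 \<rho>" for \<rho> :: real
  proof (rule holomorphic_uniform_limit)
    show "uniform_limit (cball 0 \<rho>) (\<lambda>X z. \<Sum>n\<in>X. theta_term n z) theta (finite_subsets_at_top UNIV)"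
      unfolding theta_def [abs_def]
      by (rule Weierstrass_m_test_general [OF norm_theta_term_le])
         (auto intro!: summable_on_cmult_right exp_neg_abs_summable_int)
    have "(\<lambda>z. \<Sum>n\<in>X. theta_term n z) holomorphic_on UNIV" for X
      unfolding theta_term_def by (intro holomorphic_intros)  auto
    then show "\<forall>\<^sub>F X in finite_subsets_at_top UNIV. continuous_on (cball 0 \<rho>) (\<lambda>z. \<Sum>n\<in>X. theta_term n z) \<and>
        (\<lambda>z. \<Sum>n\<in>X. theta_term n z) holomorphic_on ball 0 \<rho>"
      by (intro always_eventually allI conjI)
         (auto intro: holomorphic_on_imp_continuous_on holomorphic_on_subset)
  qed auto
  then have "\<exists>f'. (theta has_field_derivative f') (at z)" for z
    using holomorphic_on_open[of "ball 0 (cmod z + 1)" theta] by (auto)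
  then show ?thesis
    by (simp add: holomorphic_on_open)
qed

text \<open>Shifting the summation index by the integer part of 1/2 + Im z brings the centre of the
  Gaussian within distance 1 of the origin, so the remaining sum is bounded independently of
  z.\<close>

lemma norm_theta_le: obtains C where "C > 0" "\<And>z. cmod (theta z) \<le> C * exp (pi / 2 * (cmod z)\<^sup>2)"
proof -
  define C where "C = (\<Sum>\<^sub>\<infinity>n::int. exp 2 * exp (- \<bar>real_of_int n\<bar>))"
  have sm: "(\<lambda>n::int. exp 2 * exp (- \<bar>real_of_int n\<bar>)) summable_on UNIV"
    by (intro summable_on_cmult_right exp_neg_abs_summable_int)
  have "cmod (theta z) \<le> exp (pi / 2 * (cmod z)\<^sup>2) * C" for z
  proof -
    define k where "k = \<lfloor>1/2 + Im z\<rfloor>"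
    have bij: "bij (\<lambda>n. n - k)" by (rule o_bij[of "\<lambda>n. n + k"]) auto
    have le: "norm (theta_term (n - k) z) \<le> exp (pi / 2 * (cmod z)\<^sup>2) * (exp 2 * exp (- \<bar>real_of_int n\<bar>))" for n
    proof -
      define t where "t = 1/2 + Im z - of_int k"
      have t: "\<bar>t\<bar> \<le> 1" unfolding t_def k_def by linarith
      have "exp (- pi * (of_int (n - k) + 1/2 + Im z)\<^sup>2) = exp (- pi * (of_int n + t)\<^sup>2)"
        by (simp add: t_def algebra_simps)
      also have "\<dots> \<le> exp (\<bar>t\<bar> + 1) * exp (- \<bar>real_of_int n\<bar>)"
        by (rule gaussian_le_exp_neg_abs)
      also have "\<dots> \<le> exp 2 * exp (- \<bar>real_of_int n\<bar>)"
        using t by (intro mult_right_mono) auto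
      finally show ?thesis
        unfolding norm_theta_term by (simp add: mult_left_mono)
    qed
    have "theta z = (\<Sum>\<^sub>\<infinity>n. theta_term (n - k) z)"
      unfolding theta_def by (rule infsum_reindex_bij_betw [OF bij, symmetric])
    also have "cmod \<dots> \<le> (\<Sum>\<^sub>\<infinity>n. exp (pi / 2 * (cmod z)\<^sup>2) * (exp 2 * exp (- \<bar>real_of_int n\<bar>)))"
    proof (rule norm_infsum_le [OF has_sum_infsum has_sum_infsum])
      show "(\<lambda>n. theta_term (n - k) z) summable_on UNIV"
        using theta_term_summable summable_on_reindex_bij_betw [OF bij, of "\<lambda>n. theta_term n z"] by blast
      show "(\<lambda>n::int. exp (pi / 2 * (cmod z)\<^sup>2) * (exp 2 * exp (- \<bar>real_of_int n\<bar>))) summable_on UNIV"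
        by (intro summable_on_cmult_right sm)
    qed (rule le)
    finally show ?thesis by (simp add: C_def infsum_cmult_right')
  qed
  note * = this
  show thesis
  proof (rule that[of "\<bar>C\<bar> + 1"])
    fix z show "cmod (theta z) \<le> (\<bar>C\<bar> + 1) * exp (pi / 2 * (cmod z)\<^sup>2)"
      by (rule order_trans[OF *]) (simp add: mult.commute)
  qed auto
qed

lemma theta_lattice_zero: "theta (lattice_pt m k) = 0"
proof -
  define z where "z = lattice_pt m k"
  \<comment> \<open>Reflection of n + 1/2 about - k, the centre of the Gaussian at a point with
    imaginary part k; it changes the parity of n.\<close>
  let ?i = "\<lambda>n::int. - n - 1 - 2 * k"
  have bij: "bij ?i"
    by (rule o_bij[of ?i]) auto
  \<comment> \<open>The involution pairs the terms of the series with opposite signs.\<close>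
  have anti: "theta_term (?i n) z = - theta_term n z" for n
  proof -
    have 1: "(-1) powi (?i n) = - ((-1) powi n :: complex)"
      by (simp add: power_int_minus_left power_int_diff)
    define A where "A n = of_real (- pi * (of_int n + 1/2)\<^sup>2) + 2 * of_real pi * \<i> * of_real (of_int n + 1/2) * z + of_real pi * z\<^sup>2 / 2" for n :: int
    have "A n = A (?i n) + 2 * of_int (m * (2 * n + 1 + 2 * k)) * of_real pi * \<i>"
      unfolding A_def z_def lattice_pt_def
      by (simp add: complex_eq_iff power2_eq_square algebra_simps)
    then have "exp (A n) = exp (A (?i n))"
      unfolding exp_eq by (intro exI[of _ "m * (2 * n + 1 + 2 * k)"]) simp
    then show ?thesis
      unfolding theta_term_def A_def[symmetric] 1 by simp
  qed
  have "theta z = (\<Sum>\<^sub>\<infinity>n. theta_term (?i n) z)"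
    unfolding theta_def by (rule infsum_reindex_bij_betw [OF bij, symmetric])
  also have "\<dots> = - theta z"
    unfolding anti theta_def by (simp add: infsum_uminus)
  finally show ?thesis
    unfolding z_def by simp
qed

text \<open>At 1/2 the phase of the n-th exponential is i times (-1)^n and cancels the alternating
  sign, so all terms are positive multiples of one constant.\<close>

lemma theta_half_nonzero: "theta (1/2) \<noteq> 0"
proof -
  have t: "theta_term n (1/2) = \<i> * exp (of_real pi / 8) * of_real (exp (- pi * (of_int n + 1/2)\<^sup>2))" for n
  proof -
    have e: "2 * of_real pi * \<i> * of_real (of_int n + 1/2) * (1/2) = of_int n * (of_real pi * \<i>) + of_real pi * \<i> / 2"
      by (simp add: algebra_simps)
    have "exp (of_int n * (of_real pi * \<i>)) = (-1) powi n"
      by (metis exp_pi_i exp_power_int mult.commute)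
    moreover have "exp (of_real pi * \<i> / 2) = \<i>"
      by (metis exp_pi_i' cis_conv_exp cis_pi_half mult.commute times_divide_eq_left of_real_divide of_real_numeral)
    moreover have "(-1) powi n * (-1) powi n = (1::complex)"
      by (metis mult_minus1_right power_int_mult_distrib power_int_1_left verit_minus_simplify(4))
    moreover have "of_real pi * (1/2)\<^sup>2 / 2 = (of_real pi / 8 :: complex)"
      by (simp add: power_divide)
    ultimately show ?thesis
      unfolding theta_term_def e exp_add exp_of_real [symmetric] \<open>of_real pi * (1/2)\<^sup>2 / 2 = _\<close> by (simp add: mult_ac)
  qed
  have s: "(\<lambda>n::int. exp (- pi * (of_int n + 1/2)\<^sup>2)) summable_on UNIV"
    by (rule Infinite_Sum.summable_on_comparison_test [OF summable_on_cmult_right [OF exp_neg_abs_summable_int]])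
       (use gaussian_le_exp_neg_abs in auto)
  have "theta (1/2) = \<i> * exp (of_real pi / 8) * of_real (\<Sum>\<^sub>\<infinity>n::int. exp (- pi * (of_int n + 1/2)\<^sup>2))"
    unfolding theta_def t
    by (simp only: infsum_cmult_right' infsumI [OF iffD2 [OF has_sum_of_real_iff has_sum_infsum [OF s]]])
  moreover have "0 < (\<Sum>\<^sub>\<infinity>n::int. exp (- pi * (of_int n + 1/2)\<^sup>2))"
  proof -
    have "exp (- pi * (of_int 0 + 1/2)\<^sup>2) \<le> (\<Sum>\<^sub>\<infinity>n::int. exp (- pi * (of_int n + 1/2)\<^sup>2))"
      using finite_sum_le_infsum [OF s, of "{0}"] by simp
    then show ?thesis
      using exp_gt_zero less_le_trans by blast
  qed
  ultimately show ?thesis by simp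
qed

section \<open>Lattice sums\<close>

definition lat :: "int \<times> int \<Rightarrow> complex" where
  "lat p = lattice_pt (fst p) (snd p)"

text \<open>Shells of the maximum norm are boundaries of squares, so they are easily counted; the
  comparison with \<open>cmod\<close> costs a factor of at most 2.\<close>

definition sup_norm :: "int \<times> int \<Rightarrow> nat" where
  "sup_norm p = nat (max \<bar>fst p\<bar> \<bar>snd p\<bar>)"

definition lat_box :: "nat \<Rightarrow> (int \<times> int) set" where
  "lat_box n = {p. sup_norm p \<le> n}"

lemma Re_lat [simp]: "Re (lat p) = of_int (fst p)" and Im_lat [simp]: "Im (lat p) = of_int (snd p)"
  by (simp_all add: lat_def lattice_pt_def)

lemma lat_diff: "lat (p - q) = lat p - lat q"
  by (simp add: complex_eq_iff)

lemma inj_lat: "inj lat"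
  by (auto simp: inj_on_def complex_eq_iff prod_eq_iff)

lemma sup_norm_eq_0_iff [simp]: "sup_norm p = 0 \<longleftrightarrow> p = (0, 0)"
  by (auto simp: sup_norm_def prod_eq_iff)

lemma sup_norm_0 [simp]: "sup_norm (0, 0) = 0"
  by simp

lemma real_sup_norm: "real (sup_norm p) = max \<bar>Re (lat p)\<bar> \<bar>Im (lat p)\<bar>"
proof -
  have "real (sup_norm p) = of_int (max \<bar>fst p\<bar> \<bar>snd p\<bar>)"
    by (simp add: sup_norm_def)
  then show ?thesis by (simp add: of_int_max)
qed

lemma sup_norm_le_cmod_lat: "real (sup_norm p) \<le> cmod (lat p)"
  unfolding real_sup_norm by (intro max.boundedI abs_Re_le_cmod abs_Im_le_cmod)

lemma cmod_lat_le_sup_norm: "cmod (lat p) \<le> 2 * real (sup_norm p)"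
  unfolding real_sup_norm using cmod_le[of "lat p"] by linarith

lemma sup_norm_diff_le: "sup_norm (p - q) \<le> sup_norm p + sup_norm q"
proof -
  have "\<bar>fst p - fst q\<bar> \<le> max \<bar>fst p\<bar> \<bar>snd p\<bar> + max \<bar>fst q\<bar> \<bar>snd q\<bar>"
    by (rule order_trans [OF abs_triangle_ineq4]) (intro add_mono max.cobounded1)
  moreover have "\<bar>snd p - snd q\<bar> \<le> max \<bar>fst p\<bar> \<bar>snd p\<bar> + max \<bar>fst q\<bar> \<bar>snd q\<bar>"
    by (rule order_trans [OF abs_triangle_ineq4]) (intro add_mono max.cobounded2)
  ultimately have "max \<bar>fst p - fst q\<bar> \<bar>snd p - snd q\<bar> \<le> max \<bar>fst p\<bar> \<bar>snd p\<bar> + max \<bar>fst q\<bar> \<bar>snd q\<bar>"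
    by (rule max.boundedI)
  then show ?thesis
    unfolding sup_norm_def fst_diff snd_diff by (subst nat_add_distrib [symmetric]) (auto intro: nat_mono)
qed

lemma mem_lat_box: "p \<in> lat_box n \<longleftrightarrow> sup_norm p \<le> n"
  by (simp add: lat_box_def)

lemma lat_box_eq: "lat_box n = {- int n..int n} \<times> {- int n..int n}"
  by (auto simp: lat_box_def sup_norm_def)

lemma finite_lat_box [simp]: "finite (lat_box n)"
  by (simp add: lat_box_eq)

lemma card_lat_box: "card (lat_box n) = (2 * n + 1)\<^sup>2"
proof -
  have "card {- int n..int n} = 2 * n + 1" by simp
  then show ?thesis
    by (simp only: lat_box_eq card_cartesian_product power2_eq_square)
qed

lemma finite_sup_norm_eq: "finite {p. sup_norm p = k}"
  by (rule finite_subset [OF _ finite_lat_box[of k]]) (auto simp: lat_box_def)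

text \<open>The exact count is (2 k + 1)^2 - (2 k - 1)^2 = 8 k; only linear growth matters, and the
  rounded 12 recurs in the later constants.\<close>

lemma card_sup_norm_eq_le:
  assumes "k \<ge> 1"
  shows "card {p. sup_norm p = k} \<le> 12 * k"
proof -
  have "card {p. sup_norm p = k} + card (lat_box (k - 1)) = card (lat_box k)"
    using assms
    by (subst card_Un_disjoint [symmetric])
       (auto simp: finite_sup_norm_eq lat_box_def [symmetric], auto simp: lat_box_def intro!: arg_cong[of _ _ card])
  then have "card {p. sup_norm p = k} + (2 * (k - 1) + 1)\<^sup>2 = (2 * k + 1)\<^sup>2"
    by (simp only: card_lat_box)
  moreover obtain j where "k = Suc j" using assms by (cases k) auto
  ultimately show ?thesis
    by (simp add: power2_eq_square algebra_simps)
qed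

text \<open>Reduces planar lattice sums to sums over shells; the weight k gained here turns a(k) /
  k^2 into a(k) / k.\<close>

lemma sum_sup_norm_le:
  fixes h :: "nat \<Rightarrow> real"
  assumes "finite F" "finite K" "0 \<notin> K" "\<And>p. p \<in> F \<Longrightarrow> sup_norm p \<in> K" "\<And>k. k \<in> K \<Longrightarrow> h k \<ge> 0"
  shows "(\<Sum>p\<in>F. h (sup_norm p)) \<le> (\<Sum>k\<in>K. 12 * real k * h k)"
proof -
  have "(\<Sum>p\<in>F. h (sup_norm p)) = (\<Sum>k\<in>K. \<Sum>p\<in>{p\<in>F. sup_norm p = k}. h (sup_norm p))"
    using assms by (intro sum.group[symmetric]) auto
  also have "\<dots> \<le> (\<Sum>k\<in>K. 12 * real k * h k)"
  proof (rule sum_mono)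
    fix k assume k: "k \<in> K"
    have "card {p\<in>F. sup_norm p = k} \<le> 12 * k"
      using k assms by (intro order_trans[OF card_mono[OF finite_sup_norm_eq] card_sup_norm_eq_le]) (auto simp: Suc_le_eq intro: gr0I)
    then have "real (card {p\<in>F. sup_norm p = k}) \<le> 12 * real k"
      using of_nat_mono by fastforce
    then show "(\<Sum>p\<in>{p\<in>F. sup_norm p = k}. h (sup_norm p)) \<le> 12 * real k * h k"
      using assms(5)[OF k] by (simp add: mult_right_mono)
  qed
  finally show ?thesis .
qed

text \<open>After recentring at q, the terms are at most 2 / k on the k-th shell, and the shell size
  cancels the denominator, so the sum is linear in R. The hypothesis \<open>away\<close> handles q
  itself.\<close>

lemma sum_inverse_dist_le:
  fixes R :: real
  assumes R: "R \<ge> 1" and F: "finite F" "\<And>p. p \<in> F \<Longrightarrow> real (sup_norm p) \<le> 4 * R"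
    and w: "cmod w \<le> R" and cell: "\<bar>Re w - Re (lat q)\<bar> \<le> 1/2" "\<bar>Im w - Im (lat q)\<bar> \<le> 1/2"
    and away: "cmod (w - lat q) \<ge> 1/2"
  shows "(\<Sum>p\<in>F. 1 / cmod (w - lat p)) \<le> 146 * R"
proof -
  have q: "real (sup_norm q) \<le> R + 1/2"
    unfolding real_sup_norm
  proof (rule max.boundedI)
    show "\<bar>Re (lat q)\<bar> \<le> R + 1/2" using cell(1) abs_Re_le_cmod[of w] w by arith
    show "\<bar>Im (lat q)\<bar> \<le> R + 1/2" using cell(2) abs_Im_le_cmod[of w] w by arith
  qed
  \<comment> \<open>The recentred indices are bounded by 4 R + (R + 1/2) \<le> 6 R.\<close>
  define T where "T = nat \<lfloor>6 * R\<rfloor>"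
  have T: "real T \<le> 6 * R" using R by (simp add: T_def)
  have le: "1 / cmod (w - lat p) \<le> 2 / real (sup_norm (p - q))" if "p \<noteq> q" for p
  proof -
    have "sup_norm (p - q) \<noteq> 0" using that by (simp add: prod_eq_iff)
    then have 1: "real (sup_norm (p - q)) \<ge> 1" by linarith
    have "\<bar>Re (lat p - lat q)\<bar> \<le> cmod (w - lat p) + 1/2" "\<bar>Im (lat p - lat q)\<bar> \<le> cmod (w - lat p) + 1/2"
      using cell abs_Re_le_cmod[of "w - lat p"] abs_Im_le_cmod[of "w - lat p"]
      unfolding minus_complex.sel by arith+
    then have "real (sup_norm (p - q)) \<le> cmod (w - lat p) + 1/2"
      unfolding real_sup_norm lat_diff by (rule max.boundedI)
    then have "real (sup_norm (p - q)) / 2 \<le> cmod (w - lat p)"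
      using 1 by linarith
    moreover have "cmod (w - lat p) > 0" using calculation 1 by linarith
    ultimately show ?thesis using 1 by (simp add: divide_simps)
  qed
  have away': "1 / cmod (w - lat q) \<le> 2"
    using away by (subst pos_divide_le_eq) auto
  have "(\<Sum>p\<in>F. 1 / cmod (w - lat p)) \<le> (\<Sum>p\<in>insert q F. 1 / cmod (w - lat p))"
    using F by (intro sum_mono2) auto
  also have "\<dots> = 1 / cmod (w - lat q) + (\<Sum>p\<in>F - {q}. 1 / cmod (w - lat p))"
    using F by (subst sum.insert_remove) auto
  also have "\<dots> \<le> 2 + (\<Sum>p\<in>F - {q}. 2 / real (sup_norm (p - q)))"
    using away' le by (intro add_mono sum_mono) auto
  also have "(\<Sum>p\<in>F - {q}. 2 / real (sup_norm (p - q))) = (\<Sum>p\<in>(\<lambda>p. p - q) ` (F - {q}). 2 / real (sup_norm p))"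
    by (subst sum.reindex) (auto simp: inj_on_def)
  also have "\<dots> \<le> (\<Sum>k\<in>{1..T}. 12 * real k * (2 / real k))"
  proof (rule sum_sup_norm_le)
    fix p' assume "p' \<in> (\<lambda>p. p - q) ` (F - {q})"
    then obtain p where p: "p \<in> F" "p \<noteq> q" "p' = p - q" by blast
    have "sup_norm p' \<noteq> 0" using p by (simp add: prod_eq_iff)
    moreover have "real (sup_norm p') \<le> real (sup_norm p) + real (sup_norm q)"
      using sup_norm_diff_le[of p q] unfolding p(3) by (simp flip: of_nat_add)
    then have "real (sup_norm p') \<le> 6 * R" using F(2)[OF p(1)] q R by linarith
    then have "sup_norm p' \<le> T" unfolding T_def by linarith
    ultimately show "sup_norm p' \<in> {1..T}" unfolding atLeastAtMost_iff by linarith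
  qed (use F in auto)
  also have "\<dots> = (\<Sum>k\<in>{1..T}. 24)" by (intro sum.cong) auto
  also have "\<dots> = 24 * real T" by simp
  finally show ?thesis using T R by linarith
qed

section \<open>Perturbed lattices\<close>

text \<open>Quotient of the genus-one Weierstrass factors at \<open>w\<close> for the zeros \<open>g\<close> and \<open>l\<close>.\<close>

definition canonical_ratio :: "complex \<Rightarrow> complex \<Rightarrow> complex \<Rightarrow> complex" where
  "canonical_ratio l g w = (w - g) / (w - l) * (l / g) * exp (w / g - w / l)"

lemma perturbed_point_bounds:
  assumes "cmod (l - g) \<le> \<kappa> * cmod l" "\<kappa> \<le> 1/4" "l \<noteq> 0"
  shows "cmod g \<ge> cmod l / 2" "g \<noteq> 0"
proof -
  have "cmod (l - g) \<le> 1/4 * cmod l"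
    using assms by (meson mult_right_mono norm_ge_zero order_trans)
  then show "cmod g \<ge> cmod l / 2"
    using norm_triangle_ineq2[of l g] norm_ge_zero[of l] by linarith
  then show "g \<noteq> 0" using assms by auto
qed

text \<open>Each of the two quotients is 1 plus a term proportional to \<kappa>, and so is the
  exponent, whence 1 + x \<le> exp x suffices. No lower bound can hold, since w may equal g.\<close>

lemma norm_canonical_ratio_near:
  assumes "cmod (l - g) \<le> \<kappa> * cmod l" "0 \<le> \<kappa>" "\<kappa> \<le> 1/4" "l \<noteq> 0" "w \<noteq> l" "cmod w \<le> R"
  shows "cmod (canonical_ratio l g w) \<le> exp (\<kappa> * (cmod l / cmod (w - l) + 2 + 2 * R / cmod l))"
proof -
  note g = perturbed_point_bounds [OF assms(1,3,4)]
  have l: "cmod l > 0" using assms by simp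
  have R: "R \<ge> 0" using assms(6) norm_ge_zero[of w] by linarith
  have "cmod ((w - g) / (w - l)) = cmod (1 + (l - g) / (w - l))"
    using assms by (simp add: field_simps)
  also have "\<dots> \<le> 1 + cmod (l - g) / cmod (w - l)"
    by (rule norm_triangle_le) (simp add: norm_divide)
  also have "\<dots> \<le> 1 + \<kappa> * cmod l / cmod (w - l)"
    using assms by (simp add: divide_right_mono)
  also have "\<dots> \<le> exp (\<kappa> * cmod l / cmod (w - l))" by (rule exp_ge_add_one_self)
  finally have 1: "cmod ((w - g) / (w - l)) \<le> exp (\<kappa> * cmod l / cmod (w - l))" .
  have "cmod (l / g) = cmod (1 + (l - g) / g)"
    using g by (simp add: field_simps)
  also have "\<dots> \<le> 1 + cmod (l - g) / cmod g"
    by (rule norm_triangle_le) (simp add: norm_divide)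
  also have "cmod (l - g) / cmod g \<le> (\<kappa> * cmod l) / (cmod l / 2)"
    using assms g l by (intro frac_le) auto
  also have "1 + (\<kappa> * cmod l) / (cmod l / 2) = 1 + 2 * \<kappa>"
    using l by simp
  also have "\<dots> \<le> exp (2 * \<kappa>)" by (rule exp_ge_add_one_self)
  finally have 2: "cmod (l / g) \<le> exp (2 * \<kappa>)" by simp
  have "cmod (w / g - w / l) = cmod w * (cmod (l - g) / (cmod g * cmod l))"
    using g assms by (simp add: norm_divide [symmetric] norm_mult [symmetric] field_simps)
  also have "\<dots> \<le> R * ((\<kappa> * cmod l) / (cmod l / 2 * cmod l))"
    using assms g l R by (intro mult_mono frac_le) (auto intro!: mult_right_mono)
  also have "\<dots> = \<kappa> * (2 * R / cmod l)" using l by (simp add: field_simps)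
  finally have "cmod (w / g - w / l) \<le> \<kappa> * (2 * R / cmod l)" .
  then have 3: "cmod (exp (w / g - w / l)) \<le> exp (\<kappa> * (2 * R / cmod l))"
    using norm_exp[of "w / g - w / l"] by (meson exp_le_cancel_iff order_trans)
  have "cmod (canonical_ratio l g w) \<le> exp (\<kappa> * cmod l / cmod (w - l)) * exp (2 * \<kappa>) * exp (\<kappa> * (2 * R / cmod l))"
    unfolding canonical_ratio_def norm_mult by (intro mult_mono 1 2 3) auto
  also have "\<dots> = exp (\<kappa> * (cmod l / cmod (w - l) + 2 + 2 * R / cmod l))"
    unfolding exp_add [symmetric] by (simp add: algebra_simps)
  finally show ?thesis .
qed

text \<open>The exponential cancels the linear terms of both logarithms, which leaves decay of order
  1 / |l|^2 next to the factor \<kappa>. The upper half serves the growth bound, the lower half the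
  non-vanishing of the limit.\<close>

lemma norm_canonical_ratio_far:
  assumes "cmod (l - g) \<le> \<kappa> * cmod l" "0 \<le> \<kappa>" "\<kappa> \<le> 1/4" "cmod w \<le> R" "R > 0" "4 * R \<le> cmod l"
  shows "cmod (canonical_ratio l g w) \<le> exp (8 * R\<^sup>2 * \<kappa> / (cmod l)\<^sup>2)"
    and "exp (- (8 * R\<^sup>2 * \<kappa> / (cmod l)\<^sup>2)) \<le> cmod (canonical_ratio l g w)"
proof -
  have l: "cmod l > 0" "l \<noteq> 0" using assms by auto
  note g = perturbed_point_bounds [OF assms(1,3) l(2)]
  define \<rho> where "\<rho> = 2 * R / cmod l"
  have \<rho>: "\<rho> \<le> 1/2" "\<rho> \<ge> 0" using assms l by (auto simp: \<rho>_def field_simps)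
  \<comment> \<open>The ratio is \<open>exp (f u - f v)\<close>, and the derivative of \<open>f\<close> is \<open>O(u)\<close> near the origin.\<close>
  define f where "f = (\<lambda>u::complex. Ln (1 - u) + u)"
  define u v where "u = w / g" and "v = w / l"
  have u: "u \<in> cball 0 \<rho>"
  proof -
    have "cmod u \<le> R / (cmod l / 2)"
      unfolding u_def norm_divide using assms g l by (intro frac_le) auto
    then show ?thesis by (simp add: \<rho>_def mult.commute)
  qed
  have v: "v \<in> cball 0 \<rho>"
  proof -
    have "cmod v \<le> (2 * R) / cmod l"
      unfolding v_def norm_divide using assms l by (intro frac_le) auto
    then show ?thesis by (simp add: \<rho>_def)
  qed
  have uv: "cmod (u - v) \<le> 2 * R * \<kappa> / cmod l"
  proof -
    have "cmod (w / g - w / l) = cmod w * (cmod (l - g) / (cmod g * cmod l))"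
      using g l by (simp add: norm_divide [symmetric] norm_mult [symmetric] field_simps)
    also have "\<dots> \<le> R * ((\<kappa> * cmod l) / (cmod l / 2 * cmod l))"
      using assms g l by (intro mult_mono frac_le) (auto intro!: mult_right_mono)
    also have "\<dots> = 2 * R * \<kappa> / cmod l" using l by (simp add: field_simps)
    finally show ?thesis by (simp add: u_def v_def)
  qed
  have "cmod (f u - f v) \<le> (2 * \<rho>) * cmod (u - v)"
  proof (rule field_differentiable_bound [where S = "cball 0 \<rho>" and f' = "\<lambda>u. 1 - 1 / (1 - u)"])
    fix x :: complex assume x: "x \<in> cball 0 \<rho>"
    then have x': "cmod x \<le> \<rho>" by simp
    then have "Re x < 1" using complex_Re_le_cmod[of x] \<rho> by linarith
    then have "1 - x \<notin> \<real>\<^sub>\<le>\<^sub>0"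
      by (simp add: complex_nonpos_Reals_iff)
    then show "(f has_field_derivative 1 - 1 / (1 - x)) (at x within cball 0 \<rho>)"
      unfolding f_def by (auto intro!: derivative_eq_intros simp: field_simps)
    have ge: "cmod (1 - x) \<ge> 1/2"
      using norm_triangle_ineq2[of 1 x] x' \<rho> by simp
    then have "x \<noteq> 1" by auto
    then have "cmod (1 - 1 / (1 - x)) = cmod x / cmod (1 - x)"
      by (simp add: norm_divide [symmetric] field_simps norm_minus_commute)
    also have "\<dots> \<le> \<rho> / (1/2)"
      using x' ge \<rho> by (intro frac_le) auto
    finally show "cmod (1 - 1 / (1 - x)) \<le> 2 * \<rho>" by simp
  qed (use u v in auto)
  also have "\<dots> \<le> (2 * \<rho>) * (2 * R * \<kappa> / cmod l)"
    using uv \<rho> by (intro mult_left_mono) auto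
  also have "\<dots> = 8 * R\<^sup>2 * \<kappa> / (cmod l)\<^sup>2"
    by (simp add: \<rho>_def power2_eq_square)
  finally have b: "cmod (f u - f v) \<le> 8 * R\<^sup>2 * \<kappa> / (cmod l)\<^sup>2" .
  have "cmod u < 1" "cmod v < 1" using u v \<rho> by auto
  then have ne: "u \<noteq> 1" "v \<noteq> 1" by auto
  have "w \<noteq> l" using ne l unfolding v_def by auto
  have "exp (f u - f v) = (1 - u) * exp u / ((1 - v) * exp v)"
    using ne by (simp add: f_def exp_diff exp_add)
  also have "\<dots> = canonical_ratio l g w"
    unfolding canonical_ratio_def u_def v_def exp_diff
    using l g \<open>w \<noteq> l\<close> by (simp add: divide_simps) (simp add: algebra_simps)
  finally have eq: "cmod (canonical_ratio l g w) = exp (Re (f u - f v))"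
    by (metis norm_exp_eq_Re)
  show "cmod (canonical_ratio l g w) \<le> exp (8 * R\<^sup>2 * \<kappa> / (cmod l)\<^sup>2)"
    "exp (- (8 * R\<^sup>2 * \<kappa> / (cmod l)\<^sup>2)) \<le> cmod (canonical_ratio l g w)"
    unfolding eq using b abs_Re_le_cmod[of "f u - f v"] by auto
qed

text \<open>The displacement bound is indexed by the integer \<open>sup_norm p\<close>, so that the
  integral condition becomes a series. The term k = 0 of that series is 0, as division by zero
  yields 0.\<close>

locale perturbed_lattice =
  fixes g :: "int \<times> int \<Rightarrow> complex" and a :: "nat \<Rightarrow> real"
  assumes a_decseq: "decseq a"
    and a_nonneg: "0 \<le> a k"
    and a_summable: "summable (\<lambda>k. a k / real k)"
    and close: "p \<noteq> (0, 0) \<Longrightarrow> cmod (lat p - g p) \<le> a (sup_norm p) * cmod (lat p)"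
begin

text \<open>A positive limit would make the harmonic series converge by comparison.\<close>

lemma a_tendsto_0: "a \<longlonglongrightarrow> 0"
proof -
  obtain L where L: "a \<longlonglongrightarrow> L"
    using a_nonneg by (blast intro: decseq_convergent [OF a_decseq, of 0])
  have La: "L \<le> a k" for k using decseq_ge[OF a_decseq L] .
  have "L \<ge> 0" by (rule LIMSEQ_le_const[OF L]) (simp add: a_nonneg)
  moreover have "\<not> L > 0"
  proof
    assume "L > 0"
    have "summable (\<lambda>k. L / real k)"
      by (rule summable_comparison_test' [OF a_summable, of 0])
         (use La \<open>L > 0\<close> in \<open>auto intro: divide_right_mono\<close>)
    then have "summable (\<lambda>k. inverse (real k))"
      using summable_mult[of "\<lambda>k. L / real k" "1 / L"] \<open>L > 0\<close> by (simp add: field_simps)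
    then show False
      using not_summable_harmonic[where 'a=real] by simp
  qed
  ultimately show ?thesis using L by simp
qed

text \<open>One threshold for two purposes: a(K) controls the points with index up to 4 R, the tail
  sums control those beyond. Finite index sets are the form that arises from finite sets of lattice
  points.\<close>

lemma small_tail:
  assumes "e > 0"
  obtains K where "K \<ge> 1" "a K \<le> e" "\<And>A. finite A \<Longrightarrow> A \<subseteq> {K..} \<Longrightarrow> (\<Sum>k\<in>A. a k / real k) \<le> e"
proof -
  obtain K1 where K1: "\<And>k. k \<ge> K1 \<Longrightarrow> a k < e"
    using order_tendstoD(2)[OF a_tendsto_0 assms] by (auto simp: eventually_sequentially)
  obtain K2 where K2: "\<And>n. n \<ge> K2 \<Longrightarrow> norm (\<Sum>k. a (k + n) / real (k + n)) < e"
    using suminf_exist_split[OF assms a_summable] by blast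
  define K where "K = Max {1, K1, K2}"
  have K: "K \<ge> 1" "K \<ge> K1" "K \<ge> K2" by (auto simp: K_def)
  show thesis
  proof (rule that[of K])
    fix A assume A: "finite A" "A \<subseteq> {K..}"
    have "(\<Sum>k\<in>A. a k / real k) = (\<Sum>k\<in>(\<lambda>k. k - K) ` A. a (k + K) / real (k + K))"
    proof (rule sum.reindex_cong [symmetric])
      show "inj_on (\<lambda>k. k - K) A" using A by (auto simp: inj_on_def) (metis atLeast_iff eq_diff_iff subset_iff)
    qed (use A in \<open>auto simp: subset_iff\<close>)
    also have "\<dots> \<le> (\<Sum>k. a (k + K) / real (k + K))"
      using A a_nonneg by (intro sum_le_suminf summable_ignore_initial_segment[OF a_summable]) auto
    also have "\<dots> \<le> e" using K2[OF K(3)] by simp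
    finally show "(\<Sum>k\<in>A. a k / real k) \<le> e" .
  qed (use K K1[OF K(2)] in auto)
qed

end

section \<open>Moving the zeros of the theta function\<close>

text \<open>One linear factor is divided out at a time, by removability of the singularity; the
  remaining zeros survive in the quotient because they are distinct from the one removed.\<close>

lemma holomorphic_factor_finite_zeros:
  assumes "finite A" "f holomorphic_on UNIV" "\<And>a. a \<in> A \<Longrightarrow> f a = 0"
  obtains h where "h holomorphic_on UNIV" "\<And>z. f z = h z * (\<Prod>a\<in>A. z - a)"
  using assms
proof (induction A arbitrary: f thesis rule: finite_induct)
  case empty
  then show ?case by (intro empty.prems(1)[of f]) auto
next
  case (insert a A)
  define f1 where "f1 = (\<lambda>z. if z = a then deriv f a else (f z - f a) / (z - a))"
  have f1: "f1 holomorphic_on UNIV"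
    unfolding f1_def by (rule pole_lemma_open) (use insert.prems in auto)
  have fa: "f a = 0" using insert.prems by auto
  have eq: "f z = f1 z * (z - a)" for z
    using fa by (auto simp: f1_def)
  have "f1 b = 0" if "b \<in> A" for b
    using insert.hyps insert.prems(3)[of b] that eq[of b] by auto
  then obtain h where h: "h holomorphic_on UNIV" "\<And>z. f1 z = h z * (\<Prod>a\<in>A. z - a)"
    using insert.IH[of f1] f1 by blast
  have "f z = h z * (\<Prod>a\<in>insert a A. z - a)" for z
    using insert.hyps eq h(2)[of z] by (simp add: mult_ac)
  then show ?case using insert.prems(1) h(1) by blast
qed

text \<open>The cell is the unit square around the Gaussian integer nearest to z. On its boundary
  one coordinate is a half-integer, hence at distance at least 1/2 from every integer.\<close>

lemma grid_cell:
  fixes z :: complex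
  obtains q where
    "z \<in> cbox (lat q - Complex (1/2) (1/2)) (lat q + Complex (1/2) (1/2))"
    "\<And>w p. w \<in> frontier (cbox (lat q - Complex (1/2) (1/2)) (lat q + Complex (1/2) (1/2))) \<Longrightarrow>
       \<bar>Re w - Re (lat q)\<bar> \<le> 1/2 \<and> \<bar>Im w - Im (lat q)\<bar> \<le> 1/2 \<and> cmod (w - lat p) \<ge> 1/2 \<and> cmod w \<le> cmod z + 2"
proof -
  define q where "q = (round (Re z), round (Im z))"
  let ?c = "cbox (lat q - Complex (1/2) (1/2)) (lat q + Complex (1/2) (1/2))"
  have z: "\<bar>Re z - Re (lat q)\<bar> \<le> 1/2" "\<bar>Im z - Im (lat q)\<bar> \<le> 1/2"
    using of_int_round_abs_le[of "Re z"] of_int_round_abs_le[of "Im z"]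
    by (auto simp: q_def abs_minus_commute)
  show thesis
  proof (rule that[of q])
    show "z \<in> ?c"
      using z unfolding in_cbox_complex_iff atLeastAtMost_iff abs_le_iff minus_complex.sel plus_complex.sel complex.sel
      by (intro conjI; linarith)
  next
    fix w p assume "w \<in> frontier ?c"
    then have "w \<in> ?c" "w \<notin> box (lat q - Complex (1/2) (1/2)) (lat q + Complex (1/2) (1/2))"
      by (auto simp: frontier_def)
    then have r: "Re (lat q) - 1/2 \<le> Re w" "Re w \<le> Re (lat q) + 1/2" "Im (lat q) - 1/2 \<le> Im w" "Im w \<le> Im (lat q) + 1/2"
      and nr: "\<not> (Re (lat q) - 1/2 < Re w \<and> Re w < Re (lat q) + 1/2 \<and> Im (lat q) - 1/2 < Im w \<and> Im w < Im (lat q) + 1/2)"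
      by (simp_all add: in_cbox_complex_iff in_box_complex_iff)
    then have w: "\<bar>Re w - Re (lat q)\<bar> \<le> 1/2" "\<bar>Im w - Im (lat q)\<bar> \<le> 1/2"
      by (intro abs_leI; linarith)+
    have "Re w = Re (lat q) - 1/2 \<or> Re w = Re (lat q) + 1/2 \<or> Im w = Im (lat q) - 1/2 \<or> Im w = Im (lat q) + 1/2"
      using r nr by (metis order_le_less)
    then have w': "\<bar>Re w - Re (lat q)\<bar> = 1/2 \<or> \<bar>Im w - Im (lat q)\<bar> = 1/2"
      by auto
    have half: "\<bar>x - real_of_int j\<bar> \<ge> 1/2" if "\<bar>x - real_of_int i\<bar> = 1/2" for x i j
    proof (cases "i = j")
      case False
      then have "\<bar>real_of_int i - real_of_int j\<bar> \<ge> 1" by linarith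
      then show ?thesis using that by linarith
    qed (use that in auto)
    have "cmod (w - lat p) \<ge> 1/2"
    proof (rule disjE[OF w'])
      assume "\<bar>Re w - Re (lat q)\<bar> = 1/2"
      then have "\<bar>Re (w - lat p)\<bar> \<ge> 1/2" using half by simp
      then show ?thesis using abs_Re_le_cmod order_trans by blast
    next
      assume "\<bar>Im w - Im (lat q)\<bar> = 1/2"
      then have "\<bar>Im (w - lat p)\<bar> \<ge> 1/2" using half by simp
      then show ?thesis using abs_Im_le_cmod order_trans by blast
    qed
    moreover have "cmod (w - z) \<le> 2"
    proof -
      have "\<bar>Re (w - z)\<bar> \<le> 1" "\<bar>Im (w - z)\<bar> \<le> 1"
        using w z unfolding minus_complex.sel by (simp_all only: abs_le_iff) linarith+
      then show ?thesis using cmod_le[of "w - z"] by linarith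
    qed
    then have "cmod w \<le> cmod z + 2"
      using norm_triangle_sub[of w z] by linarith
    ultimately show "\<bar>Re w - Re (lat q)\<bar> \<le> 1/2 \<and> \<bar>Im w - Im (lat q)\<bar> \<le> 1/2 \<and> cmod (w - lat p) \<ge> 1/2 \<and> cmod w \<le> cmod z + 2"
      using w by blast
  qed
qed

section \<open>Products of quotients and their limit\<close>

context perturbed_lattice
begin

text \<open>Only finitely many \<open>g p\<close> can vanish; omitting their exponentials avoids dividing by zero.\<close>

definition factor :: "nat \<Rightarrow> int \<times> int \<Rightarrow> complex \<Rightarrow> complex" where
  "factor K p w = (if sup_norm p < K then (w - g p) / (w - lat p) else canonical_ratio (lat p) (g p) w)"

lemma close_tail:
  assumes "K \<ge> 1" "a K \<le> \<delta>" "sup_norm p \<ge> K"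
  shows "lat p \<noteq> 0" "a (sup_norm p) \<le> \<delta>" "cmod (lat p - g p) \<le> a (sup_norm p) * cmod (lat p)"
proof -
  have "p \<noteq> (0, 0)" using assms sup_norm_eq_0_iff[of p] by linarith
  then show "cmod (lat p - g p) \<le> a (sup_norm p) * cmod (lat p)" by (rule close)
  show "lat p \<noteq> 0" using sup_norm_le_cmod_lat[of p] assms by auto
  show "a (sup_norm p) \<le> \<delta>" using decseqD[OF a_decseq assms(3)] assms(2) by linarith
qed

text \<open>The switch at 4 R matches the range of the far estimate; below it, |lat p| \<le> 8 R
  supplies the factor \<open>8 * R\<close>. Beyond it a(k) must not be replaced by \<delta>: the
  lattice sum of 1 / |l|^2 diverges.\<close>

lemma norm_factor_le:
  assumes K: "K \<ge> 1" "a K \<le> \<delta>" "\<delta> \<le> 1/4" and p: "sup_norm p \<ge> K"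
    and R: "R \<ge> 1" "cmod w \<le> R" and w: "w \<noteq> lat p"
  shows "cmod (factor K p w) \<le> exp (if real (sup_norm p) \<le> 4 * R
      then \<delta> * (8 * R * (1 / cmod (w - lat p)) + 2 + 2 * R * (1 / real (sup_norm p)))
      else 8 * R\<^sup>2 * (a (sup_norm p) / (real (sup_norm p))\<^sup>2))"
proof -
  note c = close_tail [OF K(1,2) p]
  have k: "real (sup_norm p) \<ge> 1" "real (sup_norm p) \<le> cmod (lat p)" "cmod (lat p) \<le> 2 * real (sup_norm p)"
    using p K sup_norm_le_cmod_lat cmod_lat_le_sup_norm by auto
  have f: "factor K p w = canonical_ratio (lat p) (g p) w"
    using p by (simp add: factor_def)
  show ?thesis
  proof (cases "real (sup_norm p) \<le> 4 * R")
    case True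
    have "cmod (factor K p w) \<le> exp (a (sup_norm p) * (cmod (lat p) / cmod (w - lat p) + 2 + 2 * R / cmod (lat p)))"
      unfolding f using c K w R a_nonneg by (intro norm_canonical_ratio_near) auto
    also have "\<dots> \<le> exp (\<delta> * (8 * R * (1 / cmod (w - lat p)) + 2 + 2 * R * (1 / real (sup_norm p))))"
    proof -
      have "cmod (lat p) / cmod (w - lat p) \<le> 8 * R / cmod (w - lat p)"
        using k True by (intro divide_right_mono) auto
      moreover have "2 * R / cmod (lat p) \<le> 2 * R / real (sup_norm p)"
        using k R by (intro divide_left_mono mult_pos_pos) auto
      ultimately have "a (sup_norm p) * (cmod (lat p) / cmod (w - lat p) + 2 + 2 * R / cmod (lat p))
          \<le> \<delta> * (8 * R / cmod (w - lat p) + 2 + 2 * R / real (sup_norm p))"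
        using c R a_nonneg by (intro mult_mono add_mono) (auto intro: order_trans)
      then show ?thesis by simp
    qed
    finally show ?thesis using True by simp
  next
    case False
    have "cmod (factor K p w) \<le> exp (8 * R\<^sup>2 * a (sup_norm p) / (cmod (lat p))\<^sup>2)"
      unfolding f using c K R False k a_nonneg by (intro norm_canonical_ratio_far) auto
    also have "\<dots> \<le> exp (8 * R\<^sup>2 * a (sup_norm p) / (real (sup_norm p))\<^sup>2)"
      using k a_nonneg by (auto intro!: divide_left_mono mult_nonneg_nonneg power_mono mult_pos_pos)
    finally show ?thesis using False by simp
  qed
qed

text \<open>Here the convergence of the sum of a(k) / k controls a planar sum, because the shell
  size removes one power of k.\<close>

lemma sum_tail_le:
  assumes "K \<ge> 1" and K: "\<And>A. finite A \<Longrightarrow> A \<subseteq> {K..} \<Longrightarrow> (\<Sum>k\<in>A. a k / real k) \<le> \<delta>"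
    and F: "finite F" "\<And>p. p \<in> F \<Longrightarrow> sup_norm p \<ge> K"
  shows "(\<Sum>p\<in>F. a (sup_norm p) / (real (sup_norm p))\<^sup>2) \<le> 12 * \<delta>"
proof -
  have "(\<Sum>p\<in>F. a (sup_norm p) / (real (sup_norm p))\<^sup>2) \<le> (\<Sum>k\<in>sup_norm ` F. 12 * real k * (a k / (real k)\<^sup>2))"
    using F \<open>K \<ge> 1\<close> a_nonneg by (intro sum_sup_norm_le) fastforce+
  also have "\<dots> = 12 * (\<Sum>k\<in>sup_norm ` F. a k / real k)"
    unfolding sum_distrib_left by (intro sum.cong) (auto simp: power2_eq_square)
  also have "\<dots> \<le> 12 * \<delta>"
    using F by (intro mult_left_mono K) auto
  finally show ?thesis .
qed

text \<open>The bound does not depend on \<open>F\<close>, hence is uniform over all approximants.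
  Indices below \<open>K\<close> go into a constant, by distance at least 1/2 from the poles; the
  others go into an exponent of size \<delta> R^2.\<close>

lemma norm_prod_factor_le:
  assumes K: "K \<ge> 1" "a K \<le> \<delta>" "\<delta> \<le> 1/4"
    "\<And>A. finite A \<Longrightarrow> A \<subseteq> {K..} \<Longrightarrow> (\<Sum>k\<in>A. a k / real k) \<le> \<delta>"
    and F: "finite F"
    and R: "R \<ge> 1" "cmod w \<le> R"
    and cell: "\<bar>Re w - Re (lat q)\<bar> \<le> 1/2" "\<bar>Im w - Im (lat q)\<bar> \<le> 1/2"
    and away: "\<And>p. cmod (w - lat p) \<ge> 1/2"
  shows "cmod (\<Prod>p\<in>F. factor K p w) \<le> (\<Prod>p\<in>lat_box K. 1 + 2 * cmod (lat p - g p)) * exp (2000 * \<delta> * R\<^sup>2)"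
proof -
  define c where "c p = (if sup_norm p < K then 1 + 2 * cmod (lat p - g p) else 1)" for p
  define near where "near p = \<delta> * (8 * R * (1 / cmod (w - lat p)) + 2 + 2 * R * (1 / real (sup_norm p)))" for p
  define far where "far p = 8 * R\<^sup>2 * (a (sup_norm p) / (real (sup_norm p))\<^sup>2)" for p
  define b where "b p = (if sup_norm p < K then 0 else if real (sup_norm p) \<le> 4 * R then near p else far p)" for p
  have \<delta>: "\<delta> \<ge> 0" using K(2) a_nonneg[of K] by linarith
  have ne: "w \<noteq> lat p" for p using away[of p] by auto
  have "cmod (factor K p w) \<le> c p * exp (b p)" for p
  proof (cases "sup_norm p < K")
    case True
    have "cmod ((w - g p) / (w - lat p)) = cmod (1 + (lat p - g p) / (w - lat p))"
      using ne[of p] by (simp add: field_simps)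
    also have "\<dots> \<le> 1 + cmod (lat p - g p) / cmod (w - lat p)"
      by (rule norm_triangle_le) (simp add: norm_divide)
    also have "\<dots> \<le> 1 + cmod (lat p - g p) / (1/2)"
      using away[of p] by (intro add_left_mono divide_left_mono) auto
    finally show ?thesis using True by (simp add: factor_def c_def b_def)
  next
    case False
    then have "c p = 1" "b p = (if real (sup_norm p) \<le> 4 * R then near p else far p)" "sup_norm p \<ge> K"
      by (simp_all add: c_def b_def)
    then show ?thesis
      using norm_factor_le [OF K(1-3) _ R ne, of p] by (simp only: near_def far_def mult_1)
  qed
  then have "cmod (\<Prod>p\<in>F. factor K p w) \<le> (\<Prod>p\<in>F. c p * exp (b p))"
    unfolding prod_norm [symmetric] by (intro prod_mono) auto
  also have "\<dots> = (\<Prod>p\<in>F. c p) * exp (\<Sum>p\<in>F. b p)"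
    by (simp add: prod.distrib exp_sum F)
  also have "\<dots> \<le> (\<Prod>p\<in>lat_box K. 1 + 2 * cmod (lat p - g p)) * exp (2000 * \<delta> * R\<^sup>2)"
  proof (rule mult_mono)
    have c1: "c p \<ge> 1" for p by (simp add: c_def)
    have c0: "c p \<ge> 0" for p by (simp add: c_def)
    have "(\<Prod>p\<in>F. c p) \<le> (\<Prod>p\<in>F \<union> lat_box K. c p)"
      using F by (intro prod_mono2) (auto simp: c1 c0)
    also have "\<dots> = (\<Prod>p\<in>lat_box K. c p)"
      using F by (intro prod.mono_neutral_right) (auto simp: c_def mem_lat_box)
    also have "\<dots> \<le> (\<Prod>p\<in>lat_box K. 1 + 2 * cmod (lat p - g p))"
      by (intro prod_mono) (auto simp: c_def)
    finally show "(\<Prod>p\<in>F. c p) \<le> (\<Prod>p\<in>lat_box K. 1 + 2 * cmod (lat p - g p))" .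
    define F1 where "F1 = {p\<in>F. sup_norm p \<ge> K \<and> real (sup_norm p) \<le> 4 * R}"
    define F2 where "F2 = {p\<in>F. sup_norm p \<ge> K \<and> \<not> real (sup_norm p) \<le> 4 * R}"
    have fin: "finite F1" "finite F2" using F by (auto simp: F1_def F2_def)
    define T where "T = nat \<lfloor>4 * R\<rfloor>"
    have T: "real T \<le> 4 * R" using R by (simp add: T_def)
    have F1T: "sup_norm p \<in> {1..T}" if "p \<in> F1" for p
      using that K(1) unfolding F1_def T_def by (auto simp: le_nat_floor)
    have "(\<Sum>p\<in>F. b p) = (\<Sum>p\<in>F1. near p) + (\<Sum>p\<in>F2. far p)"
    proof -
      have "(\<Sum>p\<in>F. b p) = (\<Sum>p\<in>F1 \<union> F2. b p)"
        using F by (intro sum.mono_neutral_right) (auto simp: F1_def F2_def b_def)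
      also have "\<dots> = (\<Sum>p\<in>F1. b p) + (\<Sum>p\<in>F2. b p)"
        using fin by (intro sum.union_disjoint) (auto simp: F1_def F2_def)
      also have "(\<Sum>p\<in>F1. b p) = (\<Sum>p\<in>F1. near p)"
        by (intro sum.cong) (auto simp: F1_def b_def)
      also have "(\<Sum>p\<in>F2. b p) = (\<Sum>p\<in>F2. far p)"
        by (intro sum.cong) (auto simp: F2_def b_def)
      finally show ?thesis .
    qed
    also have "(\<Sum>p\<in>F1. near p) = \<delta> * (8 * R * (\<Sum>p\<in>F1. 1 / cmod (w - lat p)) + 2 * real (card F1)
        + 2 * R * (\<Sum>p\<in>F1. 1 / real (sup_norm p)))"
      by (simp add: near_def sum.distrib sum_distrib_left algebra_simps)
    \<comment> \<open>Here 81 comes from (2 T + 1)^2 \<le> (9 R)^2 and 48 from 12 times 4 R. With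
      the far part, 8 * 146 + 162 + 96 + 96 = 1522, rounded up to 2000 below.\<close>
    also have "\<dots> \<le> \<delta> * (8 * R * (146 * R) + 2 * (81 * R\<^sup>2) + 2 * R * (48 * R))"
    proof (intro mult_left_mono add_mono)
      show "(\<Sum>p\<in>F1. 1 / cmod (w - lat p)) \<le> 146 * R"
        using R cell away fin by (intro sum_inverse_dist_le[where q = q]) (auto simp: F1_def)
      have "card F1 \<le> card (lat_box T)"
        by (rule card_mono) (use F1T in \<open>auto simp: mem_lat_box\<close>)
      then have "real (card F1) \<le> real (card (lat_box T))" by (rule of_nat_mono)
      also have "\<dots> = (2 * real T + 1)\<^sup>2" by (simp add: card_lat_box)
      also have "\<dots> \<le> (9 * R)\<^sup>2"
        using T R by (intro power_mono) auto
      finally show "real (card F1) \<le> 81 * R\<^sup>2" by (simp add: power_mult_distrib)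
      have "(\<Sum>p\<in>F1. 1 / real (sup_norm p)) \<le> (\<Sum>k\<in>{1..T}. 12 * real k * (1 / real k))"
        using fin F1T by (intro sum_sup_norm_le) auto
      also have "\<dots> = (\<Sum>k\<in>{1..T}. 12)" by (intro sum.cong) auto
      also have "\<dots> \<le> 48 * R" using T by simp
      finally show "(\<Sum>p\<in>F1. 1 / real (sup_norm p)) \<le> 48 * R" .
    qed (use \<delta> R in auto)
    also have "(\<Sum>p\<in>F2. far p) = 8 * R\<^sup>2 * (\<Sum>p\<in>F2. a (sup_norm p) / (real (sup_norm p))\<^sup>2)"
      by (simp add: far_def sum_distrib_left)
    also have "\<dots> \<le> 8 * R\<^sup>2 * (12 * \<delta>)"
      using fin by (intro mult_left_mono sum_tail_le[OF K(1,4)]) (auto simp: F2_def)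
    finally have "(\<Sum>p\<in>F. b p) \<le> 1522 * (\<delta> * R\<^sup>2)"
      by (simp add: power2_eq_square algebra_simps)
    also have "\<dots> \<le> 2000 * (\<delta> * R\<^sup>2)"
      using \<delta> by (intro mult_right_mono) auto
    finally show "exp (\<Sum>p\<in>F. b p) \<le> exp (2000 * \<delta> * R\<^sup>2)" by simp
  qed (auto intro!: prod_nonneg add_nonneg_nonneg)
  finally show ?thesis .
qed


text \<open>All factors outside \<open>lat_box M\<close> are in the far regime at w, so together
  they can shrink the product only by a factor independent of n (with 96 = 8 * 12).\<close>

lemma norm_prod_factor_ge:
  assumes K: "K \<ge> 1" "a K \<le> \<delta>" "\<delta> \<le> 1/4"
    "\<And>A. finite A \<Longrightarrow> A \<subseteq> {K..} \<Longrightarrow> (\<Sum>k\<in>A. a k / real k) \<le> \<delta>"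
    and R: "R \<ge> 1" "cmod w \<le> R"
    and M: "M \<ge> K" "real M \<ge> 4 * R" and n: "n \<ge> M"
  shows "cmod (\<Prod>p\<in>lat_box n. factor K p w) \<ge> cmod (\<Prod>p\<in>lat_box M. factor K p w) * exp (- (96 * R\<^sup>2 * \<delta>))"
proof -
  let ?F = "lat_box n - lat_box M"
  have ge: "exp (- (8 * R\<^sup>2 * (a (sup_norm p) / (real (sup_norm p))\<^sup>2))) \<le> cmod (factor K p w)"
    if p: "p \<in> ?F" for p
  proof -
    have pM: "sup_norm p > M" using p by (simp add: mem_lat_box)
    then have pK: "sup_norm p \<ge> K" using M by linarith
    have f: "factor K p w = canonical_ratio (lat p) (g p) w"
      using pK by (simp add: factor_def)
    note c = close_tail [OF K(1,2) pK]
    have k: "real (sup_norm p) \<le> cmod (lat p)" "real (sup_norm p) \<ge> 4 * R" "real (sup_norm p) > 0"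
      using pM M R sup_norm_le_cmod_lat[of p] by auto
    have "exp (- (8 * R\<^sup>2 * (a (sup_norm p) / (real (sup_norm p))\<^sup>2))) \<le> exp (- (8 * R\<^sup>2 * a (sup_norm p) / (cmod (lat p))\<^sup>2))"
      using k a_nonneg by (auto intro!: divide_left_mono mult_nonneg_nonneg power_mono mult_pos_pos)
    also have "\<dots> \<le> cmod (factor K p w)"
      unfolding f using c K R k a_nonneg by (intro norm_canonical_ratio_far) auto
    finally show ?thesis .
  qed
  have "(\<Sum>p\<in>?F. a (sup_norm p) / (real (sup_norm p))\<^sup>2) \<le> 12 * \<delta>"
    using M by (intro sum_tail_le[OF K(1,4)]) (auto simp: mem_lat_box)
  then have "8 * R\<^sup>2 * (\<Sum>p\<in>?F. a (sup_norm p) / (real (sup_norm p))\<^sup>2) \<le> 8 * R\<^sup>2 * (12 * \<delta>)"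
    by (intro mult_left_mono) auto
  then have "exp (- (96 * R\<^sup>2 * \<delta>)) \<le> exp (\<Sum>p\<in>?F. - (8 * R\<^sup>2 * (a (sup_norm p) / (real (sup_norm p))\<^sup>2)))"
    by (simp add: sum_negf sum_distrib_left)
  also have "\<dots> \<le> (\<Prod>p\<in>?F. cmod (factor K p w))"
    unfolding exp_sum[OF finite_Diff[OF finite_lat_box]] using ge by (intro prod_mono) auto
  finally have *: "exp (- (96 * R\<^sup>2 * \<delta>)) \<le> (\<Prod>p\<in>?F. cmod (factor K p w))" .
  have "lat_box M \<subseteq> lat_box n" using n by (auto simp: mem_lat_box)
  then have "(\<Prod>p\<in>lat_box n. cmod (factor K p w)) = (\<Prod>p\<in>?F. cmod (factor K p w)) * (\<Prod>p\<in>lat_box M. cmod (factor K p w))"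
    by (rule prod.subset_diff) simp
  then show ?thesis
    unfolding prod_norm [symmetric] using mult_right_mono [OF *, of "\<Prod>p\<in>lat_box M. cmod (factor K p w)"]
    by (simp add: prod_nonneg mult.commute)
qed

text \<open>The zeros of theta in the box are divided out, which removes the poles of the product,
  and the numerators of the factors are multiplied in. The last identity is stated off the lattice
  because the factors have their poles there.\<close>

lemma approximant:
  assumes "K \<ge> 1"
  obtains P where "P holomorphic_on UNIV" "\<And>p. p \<in> lat_box n \<Longrightarrow> P (g p) = 0"
    "\<And>w. w \<notin> range lat \<Longrightarrow> P w = theta w * (\<Prod>p\<in>lat_box n. factor K p w)"
proof -
  define e where "e p z = (if sup_norm p < K then z - g p else (z - g p) * (lat p / g p) * exp (z / g p - z / lat p))" for p z
  obtain h where h: "h holomorphic_on UNIV" "\<And>z. theta z = h z * (\<Prod>a\<in>lat ` lat_box n. z - a)"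
    by (rule holomorphic_factor_finite_zeros[OF _ theta_holomorphic, of "lat ` lat_box n"])
       (auto simp: lat_def theta_lattice_zero)
  have th: "theta z = h z * (\<Prod>p\<in>lat_box n. z - lat p)" for z
    unfolding h(2) by (subst prod.reindex) (auto intro: inj_on_subset[OF inj_lat])
  have e_hol: "e p holomorphic_on UNIV" for p
  proof (cases "g p = 0 \<or> lat p = 0")
    case True
    then show ?thesis unfolding e_def
      by (cases "sup_norm p < K") (auto intro!: holomorphic_intros)
  next
    case False
    then show ?thesis unfolding e_def
      by (cases "sup_norm p < K") (auto intro!: holomorphic_intros)
  qed
  show thesis
  proof (rule that[of "\<lambda>z. h z * (\<Prod>p\<in>lat_box n. e p z)"])
    show "(\<lambda>z. h z * (\<Prod>p\<in>lat_box n. e p z)) holomorphic_on UNIV"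
      by (intro holomorphic_intros h(1) e_hol)
  next
    fix p assume "p \<in> lat_box n"
    moreover have "e p (g p) = 0" by (simp add: e_def)
    ultimately show "h (g p) * (\<Prod>q\<in>lat_box n. e q (g p)) = 0"
      by (auto intro!: prod_zero)
  next
    fix w assume w: "w \<notin> range lat"
    have "factor K p w = e p w / (w - lat p)" for p
      by (simp add: factor_def e_def canonical_ratio_def)
    then have "(\<Prod>p\<in>lat_box n. factor K p w) = (\<Prod>p\<in>lat_box n. e p w) / (\<Prod>p\<in>lat_box n. w - lat p)"
      by (simp add: prod_dividef)
    moreover have "(\<Prod>p\<in>lat_box n. w - lat p) \<noteq> 0"
      using w by (auto simp: prod_zero_iff)
    ultimately show "h w * (\<Prod>p\<in>lat_box n. e p w) = theta w * (\<Prod>p\<in>lat_box n. factor K p w)"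
      unfolding th by simp
  qed
qed

text \<open>The bound at z is inherited from the boundary of its cell, which reaches no further than
  |z| + 2. The explicit point with P z0 \<noteq> 0 excludes a trivial limit.\<close>

lemma interpolating_function:
  assumes e: "e > 0"
  shows "\<exists>P C z0. P holomorphic_on UNIV \<and> (\<forall>p. P (g p) = 0) \<and> P z0 \<noteq> 0 \<and> C > 0 \<and>
    (\<forall>z. cmod (P z) \<le> C * exp ((pi / 2 + e) * (cmod z + 2)\<^sup>2))"
proof -
  define \<delta> where "\<delta> = min (1/4) (e / 2000)"
  have \<delta>: "\<delta> > 0" "\<delta> \<le> 1/4" "2000 * \<delta> \<le> e" using e by (auto simp: \<delta>_def)
  have "\<exists>K\<ge>1. a K \<le> \<delta> \<and> (\<forall>A. finite A \<longrightarrow> A \<subseteq> {K..} \<longrightarrow> (\<Sum>k\<in>A. a k / real k) \<le> \<delta>)"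
    by (rule small_tail[OF \<delta>(1)]) blast
  then obtain K where K: "K \<ge> 1" "a K \<le> \<delta>" "\<And>A. finite A \<Longrightarrow> A \<subseteq> {K..} \<Longrightarrow> (\<Sum>k\<in>A. a k / real k) \<le> \<delta>"
    by blast
  have "\<exists>P. P holomorphic_on UNIV \<and> (\<forall>p\<in>lat_box n. P (g p) = 0) \<and>
      (\<forall>w. w \<notin> range lat \<longrightarrow> P w = theta w * (\<Prod>p\<in>lat_box n. factor K p w))" for n
    using approximant[OF K(1), of n] by metis
  then obtain P where P: "\<And>n. P n holomorphic_on UNIV" "\<And>n p. p \<in> lat_box n \<Longrightarrow> P n (g p) = 0"
    "\<And>n w. w \<notin> range lat \<Longrightarrow> P n w = theta w * (\<Prod>p\<in>lat_box n. factor K p w)"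
    by metis
  obtain C where C: "C > 0" "\<And>z. cmod (theta z) \<le> C * exp (pi / 2 * (cmod z)\<^sup>2)"
    using norm_theta_le by blast
  define M where "M = (\<Prod>p\<in>lat_box K. 1 + 2 * cmod (lat p - g p))"
  have M: "M > 0" unfolding M_def by (intro prod_pos) (auto intro: add_pos_nonneg)
  have bound: "cmod (P n z) \<le> (C * M) * exp ((pi / 2 + e) * (cmod z + 2)\<^sup>2)" for n z
  proof -
    obtain q where q: "z \<in> cbox (lat q - Complex (1/2) (1/2)) (lat q + Complex (1/2) (1/2))"
      "\<And>w p. w \<in> frontier (cbox (lat q - Complex (1/2) (1/2)) (lat q + Complex (1/2) (1/2))) \<Longrightarrow>
       \<bar>Re w - Re (lat q)\<bar> \<le> 1/2 \<and> \<bar>Im w - Im (lat q)\<bar> \<le> 1/2 \<and> cmod (w - lat p) \<ge> 1/2 \<and> cmod w \<le> cmod z + 2"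
      using grid_cell[of z] by blast
    let ?S = "cbox (lat q - Complex (1/2) (1/2)) (lat q + Complex (1/2) (1/2))"
    show ?thesis
    proof (rule maximum_modulus_frontier[OF _ _ _ _ q(1)])
      show "P n holomorphic_on interior ?S" "continuous_on (closure ?S) (P n)"
        using P(1)[of n] by (auto intro: holomorphic_on_subset holomorphic_on_imp_continuous_on)
    next
      fix w assume w: "w \<in> frontier ?S"
      define R where "R = cmod z + 2"
      have R: "R \<ge> 1" "cmod w \<le> R" using q(2)[OF w] by (auto simp: R_def)
      have away: "cmod (w - lat p) \<ge> 1/2" for p using q(2)[OF w] by blast
      have "w \<notin> range lat" proof
        assume "w \<in> range lat"
        then obtain p where "w = lat p" by blast
        then show False using away[of p] by simp
      qed
      then have "cmod (P n w) = cmod (theta w) * cmod (\<Prod>p\<in>lat_box n. factor K p w)"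
        by (simp add: P(3) norm_mult)
      also have "\<dots> \<le> (C * exp (pi / 2 * R\<^sup>2)) * (M * exp (e * R\<^sup>2))"
      proof (rule mult_mono)
        show "cmod (theta w) \<le> C * exp (pi / 2 * R\<^sup>2)"
          using R C(1) by (intro order_trans[OF C(2)] mult_left_mono) (auto intro!: power_mono)
        have "cmod (\<Prod>p\<in>lat_box n. factor K p w) \<le> M * exp (2000 * \<delta> * R\<^sup>2)"
          unfolding M_def using q(2)[OF w] away R \<delta>
          by (intro norm_prod_factor_le[where q = q] K) auto
        also have "\<dots> \<le> M * exp (e * R\<^sup>2)"
          using M \<delta> by (intro mult_left_mono) (auto intro: mult_right_mono)
        finally show "cmod (\<Prod>p\<in>lat_box n. factor K p w) \<le> M * exp (e * R\<^sup>2)" .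
      qed (use C in auto)
      also have "\<dots> = (C * M) * exp ((pi / 2 + e) * R\<^sup>2)"
        by (simp add: exp_add algebra_simps)
      finally show "cmod (P n w) \<le> (C * M) * exp ((pi / 2 + e) * (cmod z + 2)\<^sup>2)"
        by (simp add: R_def)
    qed auto
  qed
  obtain G r where G: "G holomorphic_on UNIV" "strict_mono (r :: nat \<Rightarrow> nat)" "\<And>x. (\<lambda>n. P (r n) x) \<longlonglongrightarrow> G x"
  proof (rule Montel[of UNIV "range P" P])
    show "\<exists>B. \<forall>h\<in>range P. \<forall>z\<in>A. cmod (h z) \<le> B" if A: "compact A" for A
    proof -
      obtain b where b: "\<And>z. z \<in> A \<Longrightarrow> cmod z \<le> b"
        using compact_imp_bounded[OF A] by (auto simp: bounded_iff)
      have "cmod (P n z) \<le> (C * M) * exp ((pi / 2 + e) * (b + 2)\<^sup>2)" if "z \<in> A" for n z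
      proof (rule order_trans[OF bound])
        have "(cmod z + 2)\<^sup>2 \<le> (b + 2)\<^sup>2" using b[OF that] by (intro power_mono) auto
        then show "(C * M) * exp ((pi / 2 + e) * (cmod z + 2)\<^sup>2) \<le> (C * M) * exp ((pi / 2 + e) * (b + 2)\<^sup>2)"
          using C(1) M e by (auto intro!: mult_left_mono mult_nonneg_nonneg add_nonneg_nonneg)
      qed
      then show ?thesis by blast
    qed
  qed (use P(1) in auto)
  have r: "r n \<ge> n" for n using seq_suble[OF G(2)] .
  \<comment> \<open>An open set where theta does not vanish is uncountable, whereas the lattice and
    the points g are countable.\<close>
  obtain z0 where z0: "theta z0 \<noteq> 0" "z0 \<notin> range lat" "z0 \<notin> range g"
  proof -
    have "open {z. theta z \<noteq> 0}"
      using theta_holomorphic by (intro open_Collect_neq holomorphic_on_imp_continuous_on) auto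
    then obtain e where "e > 0" "ball (1/2) e \<subseteq> {z. theta z \<noteq> 0}"
      using theta_half_nonzero open_contains_ball by blast
    then have "uncountable {z. theta z \<noteq> 0}"
      using uncountable_ball countable_subset by blast
    moreover have "countable (range lat \<union> range g)" by simp
    ultimately have "\<not> {z. theta z \<noteq> 0} \<subseteq> range lat \<union> range g"
      using countable_subset by blast
    then show ?thesis using that by blast
  qed
  have "G z0 \<noteq> 0"
  proof -
    define R where "R = cmod z0 + 1"
    have R: "R \<ge> 1" "cmod z0 \<le> R" by (auto simp: R_def)
    \<comment> \<open>Beyond \<open>N\<close> every factor is in the far regime at z0; the factors
      up to \<open>N\<close> give a fixed non-zero number.\<close>
    define N where "N = max K (nat \<lceil>4 * R\<rceil>)"
    have N: "N \<ge> K" "real N \<ge> 4 * R" unfolding N_def by linarith+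
    define c where "c = cmod (theta z0) * (cmod (\<Prod>p\<in>lat_box N. factor K p z0) * exp (- (96 * R\<^sup>2 * \<delta>)))"
    have "factor K p z0 \<noteq> 0" for p
    proof -
      have "z0 \<noteq> g p" "z0 \<noteq> lat p" using z0 by auto
      moreover have "lat p \<noteq> 0 \<and> g p \<noteq> 0" if "sup_norm p \<ge> K"
        using close_tail[OF K(1,2) that] perturbed_point_bounds(2)[of "lat p" "g p" "a (sup_norm p)"] \<delta>(2) by auto
      ultimately show ?thesis by (auto simp: factor_def canonical_ratio_def)
    qed
    then have c: "c > 0" using z0 by (simp add: c_def prod_zero_iff)
    have "cmod (G z0) \<ge> c"
    proof (rule LIMSEQ_le_const[OF tendsto_norm[OF G(3)]])
      have "c \<le> cmod (P (r n) z0)" if "n \<ge> N" for n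
        unfolding P(3)[OF z0(2)] norm_mult c_def
        using that r[of n] by (intro mult_left_mono norm_prod_factor_ge K \<delta> R N) auto
      then show "\<exists>N. \<forall>n\<ge>N. c \<le> cmod (P (r n) z0)" by blast
    qed
    then show ?thesis using c by auto
  qed
  moreover have "G (g p) = 0" for p
  proof -
    have "P (r n) (g p) = 0" if "n \<ge> sup_norm p" for n
      using that r[of n] by (intro P(2)) (simp add: mem_lat_box)
    then have "(\<lambda>n. P (r n) (g p)) \<longlonglongrightarrow> 0"
      by (intro tendsto_eventually) (auto simp: eventually_sequentially)
    then show ?thesis using LIMSEQ_unique[OF G(3)] by blast
  qed
  moreover have "cmod (G z) \<le> (C * M) * exp ((pi / 2 + e) * (cmod z + 2)\<^sup>2)" for z
    using bound by (intro LIMSEQ_le_const2[OF tendsto_norm[OF G(3)]]) auto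
  moreover have "C * M > 0" using C(1) M by simp
  ultimately show ?thesis
    using G(1) by blast
qed

end

section \<open>Area means of holomorphic functions\<close>

text \<open>Agreement on boxes characterises Lebesgue measure. The description as an image of a
  product measure makes Fubini available on the complex plane.\<close>

lemma lborel_complex_eq_distr:
  "(lborel :: complex measure) = distr (lborel \<Otimes>\<^sub>M lborel) borel (\<lambda>(x, y). Complex x y)"
proof (rule lborel_eqI)
  have m: "(\<lambda>(x, y). Complex x y) \<in> borel_measurable (lborel \<Otimes>\<^sub>M lborel)"
  proof -
    have "continuous_on UNIV (\<lambda>p::real \<times> real. Complex (fst p) (snd p))"
      unfolding Complex_eq by (intro continuous_intros)
    from borel_measurable_continuous_onI[OF this] show ?thesis
      by (simp add: lborel_prod case_prod_unfold)
  qed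
  fix l u :: complex assume le: "\<And>b. b \<in> Basis \<Longrightarrow> l \<bullet> b \<le> u \<bullet> b"
  have le': "Re l \<le> Re u" "Im l \<le> Im u"
    using le[of 1] le[of \<i>] by (auto simp: Basis_complex_def inner_complex_def)
  have "emeasure (distr (lborel \<Otimes>\<^sub>M lborel) borel (\<lambda>(x, y). Complex x y)) (box l u)
      = emeasure (lborel \<Otimes>\<^sub>M lborel) ({Re l<..<Re u} \<times> {Im l<..<Im u})"
    by (subst emeasure_distr[OF m]) (auto intro!: arg_cong2[of _ _ _ _ emeasure] simp: in_box_complex_iff space_pair_measure)
  also have "\<dots> = emeasure lborel {Re l<..<Re u} * emeasure lborel {Im l<..<Im u}"
    by (rule lborel.emeasure_pair_measure_Times) auto
  also have "\<dots> = ennreal (\<Prod>b\<in>Basis. (u - l) \<bullet> b)"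
    using le' by (simp add: Basis_complex_def inner_complex_def ennreal_mult)
  finally show "emeasure (distr (lborel \<Otimes>\<^sub>M lborel) borel (\<lambda>(x, y). Complex x y)) (box l u)
      = ennreal (\<Prod>b\<in>Basis. (u - l) \<bullet> b)" .
qed simp

text \<open>Both orders are used: one for the horizontal edges of squares, the other for the
  vertical ones.\<close>

lemma nn_integral_complex_iterated:
  assumes [measurable]: "h \<in> borel_measurable borel"
  shows "(\<integral>\<^sup>+z. h z \<partial>lborel) = (\<integral>\<^sup>+x. \<integral>\<^sup>+y. h (Complex x y) \<partial>lborel \<partial>lborel)"
    and "(\<integral>\<^sup>+z. h z \<partial>lborel) = (\<integral>\<^sup>+y. \<integral>\<^sup>+x. h (Complex x y) \<partial>lborel \<partial>lborel)"
proof -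
  have m: "(\<lambda>(x, y). Complex x y) \<in> borel_measurable (lborel \<Otimes>\<^sub>M lborel)"
  proof -
    have "continuous_on UNIV (\<lambda>p::real \<times> real. Complex (fst p) (snd p))"
      unfolding Complex_eq by (intro continuous_intros)
    from borel_measurable_continuous_onI[OF this] show ?thesis
      by (simp add: lborel_prod case_prod_unfold)
  qed
  have m': "(\<lambda>(x, y). h (Complex x y)) \<in> borel_measurable (lborel \<Otimes>\<^sub>M lborel)"
    using measurable_compose[OF m assms] by (simp add: case_prod_unfold)
  have "(\<integral>\<^sup>+z. h z \<partial>lborel) = (\<integral>\<^sup>+p. h (case p of (x, y) \<Rightarrow> Complex x y) \<partial>(lborel \<Otimes>\<^sub>M lborel))"
    by (subst lborel_complex_eq_distr) (rule nn_integral_distr[OF m], simp)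
  also have "\<dots> = (\<integral>\<^sup>+p. (case p of (x, y) \<Rightarrow> h (Complex x y)) \<partial>(lborel \<Otimes>\<^sub>M lborel))"
    by (simp add: case_prod_unfold)
  also have "\<dots> = (\<integral>\<^sup>+x. \<integral>\<^sup>+y. h (Complex x y) \<partial>lborel \<partial>lborel)"
    using lborel.nn_integral_fst[OF m'] by simp
  finally show 1: "(\<integral>\<^sup>+z. h z \<partial>lborel) = (\<integral>\<^sup>+x. \<integral>\<^sup>+y. h (Complex x y) \<partial>lborel \<partial>lborel)" .
  also have "\<dots> = (\<integral>\<^sup>+y. \<integral>\<^sup>+x. h (Complex x y) \<partial>lborel \<partial>lborel)"
    by (rule lborel_pair.Fubini'[OF m', symmetric])
  finally show "(\<integral>\<^sup>+z. h z \<partial>lborel) = (\<integral>\<^sup>+y. \<integral>\<^sup>+x. h (Complex x y) \<partial>lborel \<partial>lborel)" .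
qed

section \<open>Cauchy's formula on squares and averaging over their size\<close>

lemma contour_integral_linepath_same_Im:
  assumes "Im z = c" "Im z' = c" "Re z = a" "Re z' = b" "a < b"
  shows "contour_integral (linepath z z') f = integral {a..b} (\<lambda>x. f (Complex x c))"
proof -
  have zz': "z = Complex a c" "z' = Complex b c"
    using assms by (auto simp: complex_eq_iff)
  have lp: "linepath z z' x = Complex (a + (b - a) * x) c" for x
    by (simp add: linepath_def zz' complex_eq_iff algebra_simps)
  have "(\<lambda>x. x / (b - a)) ` {0..b - a} = {0..1}"
    using \<open>a < b\<close> by simp
  then have "integral {0..1} (\<lambda>x. f (linepath z z' x)) = integral ((\<lambda>x. x / (b - a)) ` {0..b - a}) (\<lambda>x. f (Complex (a + (b - a) * x) c))"
    by (simp add: lp)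
  also have "\<dots> = integral {a-a..b-a} (\<lambda>x. f (Complex (x + a) c)) / of_real (b - a)"
    using \<open>a < b\<close> by (subst integral_stretch_real) (auto simp: scaleR_conv_of_real add_ac)
  also have "\<dots> = integral {a..b} (\<lambda>x. f (Complex x c)) / of_real (b - a)"
    by (subst integral_shift_real_ivl) (rule refl)
  finally have i: "integral {0..1} (\<lambda>x. f (linepath z z' x)) = integral {a..b} (\<lambda>x. f (Complex x c)) / of_real (b - a)" .
  have "z' - z = of_real (b - a)"
    by (simp add: zz' complex_eq_iff)
  then have "contour_integral (linepath z z') f = of_real (b - a) * integral {0..1} (\<lambda>x. f (linepath z z' x))"
    by (simp add: contour_integral_integral)
  then show ?thesis unfolding i using \<open>a < b\<close> by simp
qed

text \<open>Cauchy's formula on a square, with 1 / |w| \<le> 1 on its boundary because s \<ge> 1.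
  Edges parallel to the axes can later be integrated over s in Cartesian coordinates.\<close>

lemma norm_center_le_square_edges:
  assumes f: "f holomorphic_on UNIV" and s: "s \<ge> 1"
  shows "2 * pi * cmod (f 0) \<le> integral {-s..s} (\<lambda>x. cmod (f (Complex x (-s)))) + integral {-s..s} (\<lambda>y. cmod (f (Complex s y)))
    + integral {-s..s} (\<lambda>x. cmod (f (Complex x s))) + integral {-s..s} (\<lambda>y. cmod (f (Complex (-s) y)))"
proof -
  define h where "h = (\<lambda>w. f w / w)"
  define a1 a2 a3 a4 where "a1 = Complex (-s) (-s)" and "a2 = Complex s (-s)" and "a3 = Complex s s" and "a4 = Complex (-s) s"
  have contf: "continuous_on UNIV f" using f by (rule holomorphic_on_imp_continuous_on)
  have re: "cmod (Complex x y) \<ge> 1" if "\<bar>x\<bar> = s \<or> \<bar>y\<bar> = s" for x y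
    using that s abs_Re_le_cmod[of "Complex x y"] abs_Im_le_cmod[of "Complex x y"] by auto
  have Re_edge: "cmod (integral {-s..s} (\<lambda>y. h (Complex c y))) \<le> integral {-s..s} (\<lambda>y. cmod (f (Complex c y)))"
    if "\<bar>c\<bar> = s" for c
  proof (rule integral_norm_bound_integral)
    have "Complex c y \<noteq> 0" for y using re[of c y] that by auto
    then show "(\<lambda>y. h (Complex c y)) integrable_on {-s..s}"
      unfolding h_def Complex_eq
      by (intro integrable_continuous_interval continuous_intros continuous_on_compose2[OF contf]) (auto simp: Complex_eq)
    show "(\<lambda>y. cmod (f (Complex c y))) integrable_on {-s..s}"
      unfolding Complex_eq by (intro integrable_continuous_interval continuous_intros continuous_on_compose2[OF contf]) auto
    fix y
    have "cmod (Complex c y) \<ge> 1" using re that by blast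
    then have "cmod (f (Complex c y)) / cmod (Complex c y) \<le> cmod (f (Complex c y)) / 1"
      by (intro divide_left_mono) auto
    then show "cmod (h (Complex c y)) \<le> cmod (f (Complex c y))"
      by (simp add: h_def norm_divide)
  qed
  have Im_edge: "cmod (integral {-s..s} (\<lambda>x. h (Complex x c))) \<le> integral {-s..s} (\<lambda>x. cmod (f (Complex x c)))"
    if "\<bar>c\<bar> = s" for c
  proof (rule integral_norm_bound_integral)
    have "Complex x c \<noteq> 0" for x using re[of x c] that by auto
    then show "(\<lambda>x. h (Complex x c)) integrable_on {-s..s}"
      unfolding h_def Complex_eq
      by (intro integrable_continuous_interval continuous_intros continuous_on_compose2[OF contf]) (auto simp: Complex_eq)
    show "(\<lambda>x. cmod (f (Complex x c))) integrable_on {-s..s}"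
      unfolding Complex_eq by (intro integrable_continuous_interval continuous_intros continuous_on_compose2[OF contf]) auto
    fix x
    have "cmod (Complex x c) \<ge> 1" using re that by blast
    then have "cmod (f (Complex x c)) / cmod (Complex x c) \<le> cmod (f (Complex x c)) / 1"
      by (intro divide_left_mono) auto
    then show "cmod (h (Complex x c)) \<le> cmod (f (Complex x c))"
      by (simp add: h_def norm_divide)
  qed
  have seg: "continuous_on (closed_segment z w) h" if "0 \<notin> closed_segment z w" for z w
    unfolding h_def using that contf by (intro continuous_intros) (auto intro: continuous_on_subset)
  have z: "0 \<notin> closed_segment a1 a2" "0 \<notin> closed_segment a2 a3" "0 \<notin> closed_segment a3 a4" "0 \<notin> closed_segment a4 a1"
    using s by (auto simp: closed_segment_same_Re closed_segment_same_Im a1_def a2_def a3_def a4_def)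
  have ci: "h contour_integrable_on linepath a1 a2" "h contour_integrable_on linepath a2 a3"
    "h contour_integrable_on linepath a3 a4" "h contour_integrable_on linepath a4 a1"
    using z seg by (auto intro!: contour_integrable_continuous_linepath)
  have box: "0 \<in> box a1 a3" using s by (auto simp: in_box_complex_iff a1_def a3_def)
  have "((\<lambda>w. f w / (w - 0)) has_contour_integral (2*pi * \<i> * winding_number (rectpath a1 a3) 0 * f 0)) (rectpath a1 a3)"
    using box s by (intro Cauchy_integral_formula_convex_simple[OF convex_UNIV f])
       (auto simp: path_image_rectpath_cbox_minus_box a1_def a3_def)
  then have "contour_integral (rectpath a1 a3) h = 2 * pi * \<i> * f 0"
    unfolding winding_number_rectpath[OF box] h_def by (simp add: contour_integral_unique)
  moreover have "contour_integral (rectpath a1 a3) h = contour_integral (linepath a1 a2) h + contour_integral (linepath a2 a3) h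
      + contour_integral (linepath a3 a4) h + contour_integral (linepath a4 a1) h"
  proof -
    have "rectpath a1 a3 = linepath a1 a2 +++ linepath a2 a3 +++ linepath a3 a4 +++ linepath a4 a1"
      by (simp add: rectpath_def Let_def a1_def a2_def a3_def a4_def)
    then show ?thesis using ci by (simp add: contour_integral_join)
  qed
  moreover have "contour_integral (linepath a1 a2) h = integral {-s..s} (\<lambda>x. h (Complex x (-s)))"
    using s by (intro contour_integral_linepath_same_Im) (auto simp: a1_def a2_def)
  moreover have "contour_integral (linepath a2 a3) h = \<i> * integral {-s..s} (\<lambda>y. h (Complex s y))"
    using s by (intro contour_integral_linepath_same_Re) (auto simp: a3_def a2_def)
  moreover have "contour_integral (linepath a3 a4) h = - contour_integral (linepath a4 a3) h"
    by (intro contour_integral_reverse_linepath seg z)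
  moreover have "contour_integral (linepath a4 a3) h = integral {-s..s} (\<lambda>x. h (Complex x s))"
    using s by (intro contour_integral_linepath_same_Im) (auto simp: a3_def a4_def)
  moreover have "contour_integral (linepath a4 a1) h = - contour_integral (linepath a1 a4) h"
    by (intro contour_integral_reverse_linepath seg z)
  moreover have "contour_integral (linepath a1 a4) h = \<i> * integral {-s..s} (\<lambda>y. h (Complex (-s) y))"
    using s by (intro contour_integral_linepath_same_Re) (auto simp: a1_def a4_def)
  ultimately have eq: "2 * pi * \<i> * f 0 = integral {-s..s} (\<lambda>x. h (Complex x (-s))) + \<i> * integral {-s..s} (\<lambda>y. h (Complex s y))
     + (- integral {-s..s} (\<lambda>x. h (Complex x s))) + (- (\<i> * integral {-s..s} (\<lambda>y. h (Complex (-s) y))))"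
    by simp
  have "2 * pi * cmod (f 0) = cmod (2 * pi * \<i> * f 0)"
    by (simp add: norm_mult)
  also have "\<dots> \<le> cmod (integral {-s..s} (\<lambda>x. h (Complex x (-s)))) + cmod (integral {-s..s} (\<lambda>y. h (Complex s y)))
     + cmod (integral {-s..s} (\<lambda>x. h (Complex x s))) + cmod (integral {-s..s} (\<lambda>y. h (Complex (-s) y)))"
    unfolding eq
    by (intro norm_triangle_le add_mono order_refl) (auto simp: norm_mult)
  also have "\<dots> \<le> integral {-s..s} (\<lambda>x. cmod (f (Complex x (-s)))) + integral {-s..s} (\<lambda>y. cmod (f (Complex s y)))
    + integral {-s..s} (\<lambda>x. cmod (f (Complex x s))) + integral {-s..s} (\<lambda>y. cmod (f (Complex (-s) y)))"
    using s by (intro add_mono Re_edge Im_edge) auto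
  finally show ?thesis .
qed

lemma integral_le_nn_integral:
  fixes u :: "real \<Rightarrow> real"
  assumes "continuous_on UNIV u" "\<And>x. u x \<ge> 0" "s \<le> 2"
  shows "ennreal (integral {-s..s} u) \<le> (\<integral>\<^sup>+x. ennreal (u x) * indicator {-2..2} x \<partial>lborel)"
proof -
  have "(u has_integral integral {-s..s} u) {-s..s}"
    using assms by (intro integrable_integral integrable_continuous_interval) (auto intro: continuous_on_subset)
  then have "ennreal (integral {-s..s} u) = (\<integral>\<^sup>+x. ennreal (u x) * indicator {-s..s} x \<partial>lborel)"
    using assms
    by (intro nn_integral_has_integral_lebesgue'[symmetric]) auto
  also have "\<dots> \<le> (\<integral>\<^sup>+x. ennreal (u x) * indicator {-2..2} x \<partial>lborel)"
    using assms(3) by (intro nn_integral_mono mult_left_mono) (auto simp: indicator_def)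
  finally show ?thesis .
qed


text \<open>The edge estimate is averaged over s in [1, 2], an interval of length 1. Each of the
  four families of edges sweeps out part of the square of half-width 2, hence the factor 4.\<close>

lemma norm_le_nn_integral_square:
  assumes f: "f holomorphic_on UNIV"
  shows "ennreal (2 * pi * cmod (f 0)) \<le> 4 * (\<integral>\<^sup>+z. ennreal (cmod (f z)) * indicator (cbox (Complex (-2) (-2)) (Complex 2 2)) z \<partial>lborel)"
proof -
  let ?Q = "cbox (Complex (-2) (-2)) (Complex 2 2)"
  define I where "I = (\<integral>\<^sup>+z. ennreal (cmod (f z)) * indicator ?Q z \<partial>lborel)"
  define A where "A y = (\<integral>\<^sup>+x. ennreal (cmod (f (Complex x y))) * indicator {-2..2} x \<partial>lborel)" for y
  define B where "B x = (\<integral>\<^sup>+y. ennreal (cmod (f (Complex x y))) * indicator {-2..2} y \<partial>lborel)" for x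
  have contf: "continuous_on UNIV f" using f by (rule holomorphic_on_imp_continuous_on)
  have cont1: "continuous_on UNIV (\<lambda>x. cmod (f (Complex x y)))" for y
    unfolding Complex_eq by (intro continuous_intros continuous_on_compose2[OF contf]) auto
  have cont2: "continuous_on UNIV (\<lambda>y. cmod (f (Complex x y)))" for x
    unfolding Complex_eq by (intro continuous_intros continuous_on_compose2[OF contf]) auto
  have meas_pair: "(\<lambda>p. cmod (f (Complex (fst p) (snd p)))) \<in> borel_measurable (borel \<Otimes>\<^sub>M borel)"
  proof -
    have "continuous_on UNIV (\<lambda>p::real \<times> real. cmod (f (Complex (fst p) (snd p))))"
      unfolding Complex_eq by (intro continuous_intros continuous_on_compose2[OF contf]) auto
    from borel_measurable_continuous_onI[OF this] show ?thesis by (simp add: borel_prod)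
  qed
  have [measurable]: "(\<lambda>(x, y). ennreal (cmod (f (Complex x y)))) \<in> borel_measurable (borel \<Otimes>\<^sub>M borel)"
    "(\<lambda>(y, x). ennreal (cmod (f (Complex x y)))) \<in> borel_measurable (borel \<Otimes>\<^sub>M borel)"
    using meas_pair measurable_compose[OF measurable_pair_swap' meas_pair] by (auto simp: case_prod_unfold)
  have A [measurable]: "A \<in> borel_measurable borel" and B [measurable]: "B \<in> borel_measurable borel"
    unfolding A_def [abs_def] B_def [abs_def] by measurable
  have [measurable]: "f \<in> borel_measurable borel" using contf by (rule borel_measurable_continuous_onI)
  have ind: "indicator ?Q (Complex x y) = (indicator {-2..2} x * indicator {-2..2} y :: ennreal)" for x y
    by (auto simp: in_cbox_complex_iff indicator_def)
  have [measurable]: "(\<lambda>x. cmod (f (Complex x y))) \<in> borel_measurable borel" "(\<lambda>y. cmod (f (Complex x y))) \<in> borel_measurable borel" for x y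
    using cont1 cont2 by (auto intro: borel_measurable_continuous_onI)
  have mA: "A y * indicator {-2..2} y = (\<integral>\<^sup>+x. ennreal (cmod (f (Complex x y))) * indicator ?Q (Complex x y) \<partial>lborel)" for y
    unfolding A_def ind by (subst nn_integral_multc [symmetric]) (auto simp: mult_ac)
  have mB: "B x * indicator {-2..2} x = (\<integral>\<^sup>+y. ennreal (cmod (f (Complex x y))) * indicator ?Q (Complex x y) \<partial>lborel)" for x
    unfolding B_def ind by (subst nn_integral_multc [symmetric]) (auto simp: mult_ac)
  have IA: "(\<integral>\<^sup>+y. A y * indicator {-2..2} y \<partial>lborel) = I"
    unfolding I_def mA by (rule nn_integral_complex_iterated(2) [symmetric]) auto
  have IB: "(\<integral>\<^sup>+x. B x * indicator {-2..2} x \<partial>lborel) = I"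
    unfolding I_def mB by (rule nn_integral_complex_iterated(1) [symmetric]) auto
  have pt: "ennreal (2 * pi * cmod (f 0)) \<le> A (-s) + B s + A s + B (-s)" if "1 \<le> s" "s \<le> 2" for s
  proof -
    note bd = integral_le_nn_integral[OF _ _ that(2)]
    have "ennreal (2 * pi * cmod (f 0)) \<le> ennreal (integral {-s..s} (\<lambda>x. cmod (f (Complex x (-s)))) + integral {-s..s} (\<lambda>y. cmod (f (Complex s y)))
    + integral {-s..s} (\<lambda>x. cmod (f (Complex x s))) + integral {-s..s} (\<lambda>y. cmod (f (Complex (-s) y))))"
      by (rule ennreal_leI [OF norm_center_le_square_edges[OF f that(1)]])
    also have "\<dots> = ennreal (integral {-s..s} (\<lambda>x. cmod (f (Complex x (-s))))) + ennreal (integral {-s..s} (\<lambda>y. cmod (f (Complex s y))))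
    + ennreal (integral {-s..s} (\<lambda>x. cmod (f (Complex x s)))) + ennreal (integral {-s..s} (\<lambda>y. cmod (f (Complex (-s) y))))"
      by (simp add: ennreal_plus integral_nonneg integrable_continuous_interval continuous_on_subset[OF cont1] continuous_on_subset[OF cont2])
    also have "\<dots> \<le> A (-s) + B s + A s + B (-s)"
      unfolding A_def B_def by (intro add_mono bd cont1 cont2) auto
    finally show ?thesis .
  qed
  \<comment> \<open>Edges at - s with s in [1, 2] sweep the coordinates in [-2, -1].\<close>
  have neg: "(\<integral>\<^sup>+s. H (-s) * indicator {1..2} s \<partial>lborel) \<le> (\<integral>\<^sup>+s. H s * indicator {-2..2} s \<partial>lborel)"
    if [measurable]: "H \<in> borel_measurable borel" for H :: "real \<Rightarrow> ennreal"
  proof -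
    have "(\<integral>\<^sup>+s. H s * indicator {-2..-1} s \<partial>lborel) = (\<integral>\<^sup>+s. H (-s) * indicator {-2..-1} (-s) \<partial>lborel)"
      by (subst nn_integral_real_affine[where c = "-1" and t = 0]) auto
    also have "\<dots> = (\<integral>\<^sup>+s. H (-s) * indicator {1..2} s \<partial>lborel)"
      by (intro nn_integral_cong) (auto simp: indicator_def)
    finally have "(\<integral>\<^sup>+s. H (-s) * indicator {1..2} s \<partial>lborel) = (\<integral>\<^sup>+s. H s * indicator {-2..-1} s \<partial>lborel)" ..
    also have "\<dots> \<le> (\<integral>\<^sup>+s. H s * indicator {-2..2} s \<partial>lborel)"
      by (intro nn_integral_mono mult_left_mono) (auto simp: indicator_def)
    finally show ?thesis .
  qed
  have pos: "(\<integral>\<^sup>+s. H s * indicator {1..2} s \<partial>lborel) \<le> (\<integral>\<^sup>+s. H s * indicator {-2..2} s \<partial>lborel)"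
    for H :: "real \<Rightarrow> ennreal"
    by (intro nn_integral_mono mult_left_mono) (auto simp: indicator_def)
  have "ennreal (2 * pi * cmod (f 0)) = (\<integral>\<^sup>+s. ennreal (2 * pi * cmod (f 0)) * indicator {1..2} s \<partial>(lborel :: real measure))"
    by (simp add: nn_integral_cmult)
  also have "\<dots> \<le> (\<integral>\<^sup>+s. (A (-s) + B s + A s + B (-s)) * indicator {1..2} s \<partial>lborel)"
    using pt by (intro nn_integral_mono) (auto simp: indicator_def)
  also have "\<dots> = (\<integral>\<^sup>+s. A (-s) * indicator {1..2} s \<partial>lborel) + (\<integral>\<^sup>+s. B s * indicator {1..2} s \<partial>lborel)
      + (\<integral>\<^sup>+s. A s * indicator {1..2} s \<partial>lborel) + (\<integral>\<^sup>+s. B (-s) * indicator {1..2} s \<partial>lborel)"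
    by (simp add: distrib_right nn_integral_add)
  also have "\<dots> \<le> I + I + I + I"
    using neg[OF A] neg[OF B] pos[of A] pos[of B] unfolding IA IB by (intro add_mono)
  also have "\<dots> = (1 + 1 + 1 + 1) * I" by (simp only: distrib_right mult_1)
  finally show ?thesis unfolding I_def by simp
qed

section \<open>Growth and zeros\<close>

text \<open>The area mean around z0 is compared with the Fock integral; on the square the Gaussian
  weight varies by no more than the factor with |z0| + 3 allows.\<close>

lemma fock_pointwise_bound:
  assumes "F \<in> fock_space"
  obtains C where "C > 0" "\<And>z. cmod (F z) \<le> C * exp (pi / 2 * (cmod z + 3)\<^sup>2)"
proof -
  have F: "F holomorphic_on UNIV" and int: "integrable lborel (\<lambda>z. (cmod (F z))\<^sup>2 * exp (- pi * (cmod z)\<^sup>2))"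
    using assms by (auto simp: fock_space_def)
  define H where "H z = (cmod (F z))\<^sup>2 * exp (- pi * (cmod z)\<^sup>2)" for z
  define N where "N = (\<integral>z. H z \<partial>lborel)"
  have H0: "H z \<ge> 0" for z by (simp add: H_def)
  have N: "(\<integral>\<^sup>+z. ennreal (H z) \<partial>lborel) = ennreal N" "N \<ge> 0"
    using int H0 unfolding N_def H_def [abs_def] by (auto intro!: nn_integral_eq_integral integral_nonneg_AE)
  have [measurable]: "H \<in> borel_measurable borel"
    using int unfolding H_def [abs_def] by (simp add: borel_measurable_integrable)
  have bd: "(cmod (F z0))\<^sup>2 \<le> N * exp (pi * (cmod z0 + 3)\<^sup>2)" for z0
  proof -
    \<comment> \<open>Squaring F makes |F|^2 the modulus of a holomorphic function.\<close>
    define f where "f = (\<lambda>w. (F (z0 + w))\<^sup>2)"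
    have f: "f holomorphic_on UNIV"
      unfolding f_def by (intro holomorphic_intros holomorphic_on_compose_gen[OF _ F, unfolded o_def]) auto
    have "ennreal (2 * pi * cmod (f 0)) \<le> 4 * (\<integral>\<^sup>+z. ennreal (cmod (f z)) * indicator (cbox (Complex (-2) (-2)) (Complex 2 2)) z \<partial>lborel)"
      by (rule norm_le_nn_integral_square[OF f])
    also have "\<dots> \<le> 4 * (\<integral>\<^sup>+w. ennreal (exp (pi * (cmod z0 + 3)\<^sup>2)) * ennreal (H (z0 + w)) \<partial>lborel)"
    proof (intro mult_left_mono nn_integral_mono)
      fix w :: complex
      show "ennreal (cmod (f w)) * indicator (cbox (Complex (-2) (-2)) (Complex 2 2)) w \<le> ennreal (exp (pi * (cmod z0 + 3)\<^sup>2)) * ennreal (H (z0 + w))"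
      proof (cases "w \<in> cbox (Complex (-2) (-2)) (Complex 2 2)")
        case True
        then have "\<bar>Re w\<bar> \<le> 2" "\<bar>Im w\<bar> \<le> 2" by (auto simp: in_cbox_complex_iff)
        then have "(Re w)\<^sup>2 \<le> 2\<^sup>2" "(Im w)\<^sup>2 \<le> 2\<^sup>2" 
          using abs_le_square_iff[of "Re w" 2] abs_le_square_iff[of "Im w" 2] by simp_all
        \<comment> \<open>A point of the square satisfies |w|^2 \<le> 8; the radius is rounded up to
          3.\<close>
        then have "(cmod w)\<^sup>2 \<le> 3\<^sup>2" unfolding cmod_power2 by simp
        then have "cmod w \<le> 3" by (rule power2_le_imp_le) simp
        then have "cmod (z0 + w) \<le> cmod z0 + 3" using norm_triangle_ineq[of z0 w] by linarith
        then have "(cmod (z0 + w))\<^sup>2 \<le> (cmod z0 + 3)\<^sup>2" by (intro power_mono) auto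
        then have "exp (pi * (cmod (z0 + w))\<^sup>2) \<le> exp (pi * (cmod z0 + 3)\<^sup>2)" by simp
        then have "exp (pi * (cmod (z0 + w))\<^sup>2) * H (z0 + w) \<le> exp (pi * (cmod z0 + 3)\<^sup>2) * H (z0 + w)"
          using H0 by (rule mult_right_mono)
        moreover have "exp (pi * (cmod (z0 + w))\<^sup>2) * H (z0 + w) = cmod (f w)"
          by (simp add: H_def f_def norm_power exp_minus)
        ultimately show ?thesis using True H0 by (simp add: ennreal_mult [symmetric])
      qed auto
    qed auto
    also have "(\<integral>\<^sup>+w. ennreal (exp (pi * (cmod z0 + 3)\<^sup>2)) * ennreal (H (z0 + w)) \<partial>lborel)
        = ennreal (exp (pi * (cmod z0 + 3)\<^sup>2)) * (\<integral>\<^sup>+w. ennreal (H (z0 + w)) \<partial>lborel)"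
      by (rule nn_integral_cmult) simp
    also have "(\<integral>\<^sup>+w. ennreal (H (z0 + w)) \<partial>lborel) = (\<integral>\<^sup>+w. ennreal (H w) \<partial>distr lborel borel ((+) z0))"
      by (subst nn_integral_distr) auto
    also have "\<dots> = ennreal N" by (simp add: lborel_distr_plus N)
    also have "4 * (ennreal (exp (pi * (cmod z0 + 3)\<^sup>2)) * ennreal N) = ennreal (4 * (exp (pi * (cmod z0 + 3)\<^sup>2) * N))"
      using N by (simp add: ennreal_mult)
    finally have "2 * pi * cmod (f 0) \<le> 4 * (exp (pi * (cmod z0 + 3)\<^sup>2) * N)"
      using N(2) by (subst (asm) ennreal_le_iff) auto
    moreover have "4 * cmod (f 0) \<le> 2 * pi * cmod (f 0)"
      using pi_gt3 by (intro mult_right_mono) auto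
    ultimately have "cmod (f 0) \<le> exp (pi * (cmod z0 + 3)\<^sup>2) * N" by linarith
    then show ?thesis by (simp add: f_def norm_power mult.commute)
  qed
  show thesis
  proof (rule that[of "sqrt N + 1"])
    show "sqrt N + 1 > 0" using N(2) by (simp add: add_nonneg_pos)
    fix z
    have "cmod (F z) = sqrt ((cmod (F z))\<^sup>2)" by simp
    also have "\<dots> \<le> sqrt (N * exp (pi * (cmod z + 3)\<^sup>2))" by (rule real_sqrt_le_mono[OF bd])
    also have "\<dots> = sqrt N * exp (pi / 2 * (cmod z + 3)\<^sup>2)"
    proof -
      have "exp (pi * (cmod z + 3)\<^sup>2) = (exp (pi / 2 * (cmod z + 3)\<^sup>2))\<^sup>2"
        by (simp add: power2_eq_square flip: exp_add)
      then show ?thesis by (simp add: real_sqrt_mult)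
    qed
    also have "\<dots> \<le> (sqrt N + 1) * exp (pi / 2 * (cmod z + 3)\<^sup>2)"
      by (intro mult_right_mono) auto
    finally show "cmod (F z) \<le> (sqrt N + 1) * exp (pi / 2 * (cmod z + 3)\<^sup>2)" .
  qed
qed

text \<open>Jensen's formula in multiplicative form, with the circle mean of log |f| replaced by the
  maximum; no logarithm of a possibly vanishing function occurs.\<close>

lemma jensen_inequality:
  assumes f: "f holomorphic_on UNIV" and A: "finite A" "\<And>a. a \<in> A \<Longrightarrow> f a = 0"
    and R: "R > 0" and B: "\<And>z. cmod (z - z0) = R \<Longrightarrow> cmod (f z) \<le> B"
  shows "cmod (f z0) * R ^ card A \<le> B * (\<Prod>a\<in>A. cmod (a - z0))"
proof -
  obtain h where h: "h holomorphic_on UNIV" "\<And>z. f z = h z * (\<Prod>a\<in>A. z - a)"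
    using holomorphic_factor_finite_zeros[OF A(1) f A(2)] by blast
  \<comment> \<open>The zeros are removed by Blaschke factors, which have constant modulus on the circle.\<close>
  define G where "G z = h z * (\<Prod>a\<in>A. of_real (R\<^sup>2) - cnj (a - z0) * (z - z0))" for z
  have G: "G holomorphic_on UNIV"
    unfolding G_def by (intro holomorphic_intros h(1))
  have "cmod (G z0) \<le> B * R ^ card A"
  proof (rule maximum_modulus_frontier[of G "cball z0 R"])
    show "G holomorphic_on interior (cball z0 R)" "continuous_on (closure (cball z0 R)) G"
      using G by (auto intro: holomorphic_on_subset holomorphic_on_imp_continuous_on)
    fix z assume "z \<in> frontier (cball z0 R)"
    then have z: "cmod (z - z0) = R" using R by (simp add: frontier_cball sphere_def dist_norm norm_minus_commute)
    have fac: "cmod (of_real (R\<^sup>2) - cnj (a - z0) * (z - z0)) = R * cmod (z - a)" for a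
    proof -
      have "of_real (R\<^sup>2) = (z - z0) * cnj (z - z0)"
        using z by (metis complex_norm_square)
      then have "of_real (R\<^sup>2) - cnj (a - z0) * (z - z0) = (z - z0) * cnj (z - a)"
        by (simp add: algebra_simps)
      then show ?thesis using z by (simp only: norm_mult complex_mod_cnj)
    qed
    have "cmod (G z) = cmod (f z) * R ^ card A"
      unfolding G_def h(2) norm_mult prod_norm [symmetric] fac by (simp add: prod.distrib)
    also have "\<dots> \<le> B * R ^ card A"
      using R B[OF z] by (intro mult_right_mono) auto
    finally show "cmod (G z) \<le> B * R ^ card A" .
  qed (use R in auto)
  \<comment> \<open>At the centre each factor equals R^2, which gives \<open>card A\<close> further
    powers of R than on the circle side.\<close>
  moreover have "cmod (G z0) = cmod (h z0) * R ^ card A * R ^ card A"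
    using R by (simp add: G_def norm_mult norm_power power2_eq_square power_mult_distrib)
  ultimately have "cmod (h z0) * R ^ card A \<le> B"
    using R by (simp add: mult_le_cancel_right)
  then have "cmod (h z0) * R ^ card A * (\<Prod>a\<in>A. cmod (a - z0)) \<le> B * (\<Prod>a\<in>A. cmod (a - z0))"
    by (intro mult_right_mono) (auto intro: prod_nonneg)
  then show ?thesis
    unfolding h(2) norm_mult prod_norm [symmetric] by (simp add: mult_ac norm_minus_commute)
qed

text \<open>Unit squares around the lattice points of the disc cover the disc of radius t - 1, since
  half a diagonal is less than 1. The sharp leading constant pi matters: it places the threshold at
  d = 1.\<close>

lemma card_lat_disc_ge:
  assumes t: "t \<ge> 1"
  shows "finite {p. cmod (lat p) \<le> t}" "pi * (t - 1)\<^sup>2 \<le> real (card {p. cmod (lat p) \<le> t})"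
proof -
  let ?D = "{p. cmod (lat p) \<le> t}"
  have "?D \<subseteq> lat_box (nat \<lfloor>t\<rfloor>)"
  proof
    fix p assume "p \<in> ?D"
    then have "real (sup_norm p) \<le> t" using sup_norm_le_cmod_lat[of p] by auto
    then show "p \<in> lat_box (nat \<lfloor>t\<rfloor>)" by (simp add: mem_lat_box le_nat_floor)
  qed
  then show fin: "finite ?D" by (rule finite_subset) simp
  define S where "S p = cbox (lat p - Complex (1/2) (1/2)) (lat p + Complex (1/2) (1/2))" for p
  have "emeasure lborel (S p) = 1" for p
    by (simp add: S_def emeasure_lborel_cbox_eq Basis_complex_def inner_complex_def)
  then have "(\<Sum>p\<in>?D. emeasure lborel (S p)) = ennreal (real (card ?D))"
    by (simp add: ennreal_of_nat_eq_real_of_nat)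
  moreover have "emeasure lborel (\<Union>p\<in>?D. S p) \<le> (\<Sum>p\<in>?D. emeasure lborel (S p))"
    using fin by (intro emeasure_subadditive_finite) (auto simp: S_def)
  moreover have "ball 0 (t - 1) \<subseteq> (\<Union>p\<in>?D. S p)"
  proof
    fix z :: complex assume z: "z \<in> ball 0 (t - 1)"
    define p where "p = (round (Re z), round (Im z))"
    have r: "\<bar>Re z - Re (lat p)\<bar> \<le> 1/2" "\<bar>Im z - Im (lat p)\<bar> \<le> 1/2"
      using of_int_round_abs_le[of "Re z"] of_int_round_abs_le[of "Im z"]
      by (auto simp: p_def abs_minus_commute)
    then have "cmod (lat p - z) \<le> 1"
      using cmod_le[of "lat p - z"] unfolding minus_complex.sel by (simp add: abs_minus_commute)
    then have "cmod (lat p) \<le> t"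
      using z norm_triangle_sub[of "lat p" z] by auto
    moreover have "z \<in> S p"
      using r unfolding S_def in_cbox_complex_iff atLeastAtMost_iff abs_le_iff minus_complex.sel plus_complex.sel complex.sel
      by (intro conjI; linarith)
    ultimately show "z \<in> (\<Union>p\<in>?D. S p)" by blast
  qed
  then have "emeasure lborel (ball (0::complex) (t - 1)) \<le> emeasure lborel (\<Union>p\<in>?D. S p)"
    using fin by (intro emeasure_mono) (auto simp: S_def)
  moreover have "emeasure lborel (ball (0::complex) (t - 1)) = ennreal (pi * (t - 1)\<^sup>2)"
    using t by (subst emeasure_ball) (auto simp: unit_ball_vol_2 )
  ultimately have "ennreal (pi * (t - 1)\<^sup>2) \<le> ennreal (real (card ?D))"
    by (metis order_trans)
  then show "pi * (t - 1)\<^sup>2 \<le> real (card ?D)"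
    by (subst (asm) ennreal_le_iff) auto
qed

section \<open>Regular sequences\<close>

lemma quadratic_not_le_affine:
  fixes \<alpha> :: real
  assumes "\<alpha> > 0" "\<And>R. R \<ge> R0 \<Longrightarrow> \<alpha> * R\<^sup>2 \<le> \<beta> * R + \<eta>"
  shows False
proof -
  define R where "R = max R0 ((\<bar>\<beta>\<bar> + \<bar>\<eta>\<bar>) / \<alpha> + 1)"
  have R: "R \<ge> R0" "R \<ge> (\<bar>\<beta>\<bar> + \<bar>\<eta>\<bar>) / \<alpha> + 1" by (auto simp: R_def)
  have "(\<bar>\<beta>\<bar> + \<bar>\<eta>\<bar>) / \<alpha> \<ge> 0" using assms(1) by (intro divide_nonneg_pos) auto
  then have R1: "R \<ge> 1" using R by linarith
  have "\<bar>\<beta>\<bar> + \<bar>\<eta>\<bar> < \<alpha> * R" using R assms(1) by (simp add: field_simps)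
  then have "(\<bar>\<beta>\<bar> + \<bar>\<eta>\<bar>) * R < \<alpha> * R * R" using R1 by (intro mult_strict_right_mono) auto
  moreover have "\<bar>\<eta>\<bar> * 1 \<le> \<bar>\<eta>\<bar> * R" using R1 by (intro mult_left_mono) auto
  moreover have "\<beta> * R \<le> \<bar>\<beta>\<bar> * R" using R1 by (intro mult_right_mono) auto
  ultimately have "\<beta> * R + \<eta> < \<alpha> * R\<^sup>2" by (simp add: power2_eq_square algebra_simps)
  then show False using assms(2)[OF R(1)] by linarith
qed

text \<open>Integral test: h(n + 2) is at most the integral over (n + 1, n + 2], which lies in the
  domain where h is controlled.\<close>

lemma summable_antimono_integrable:
  fixes h :: "real \<Rightarrow> real"
  assumes int: "set_integrable lborel {1..} h" and anti: "antimono_on {1..} h" and nn: "\<And>t. t \<ge> 1 \<Longrightarrow> h t \<ge> 0"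
  shows "summable (\<lambda>k. h (real k))"
proof -
  have sub: "set_integrable lborel S h" if "S \<subseteq> {1..}" "S \<in> sets lborel" for S
    using set_integrable_subset[OF int that(2,1)] .
  have step: "h (real n + 2) \<le> (LINT t:{real n + 1<..real n + 2}|lborel. h t)" for n
  proof -
    have "h (real n + 2) = (LINT t:{real n + 1<..real n + 2}|lborel. h (real n + 2))"
      by (simp add: set_lebesgue_integral_def)
    also have "\<dots> \<le> (LINT t:{real n + 1<..real n + 2}|lborel. h t)"
    proof (rule set_integral_mono)
      show "set_integrable lborel {real n + 1<..real n + 2} (\<lambda>t. h (real n + 2))"
        by (simp add: set_integrable_def)
      show "set_integrable lborel {real n + 1<..real n + 2} h" by (rule sub) auto
    qed (auto intro: monotone_onD[OF anti])
    finally show ?thesis .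
  qed
  have le: "(\<Sum>k<n. h (real k + 2)) \<le> (LINT t:{1..real n + 1}|lborel. h t)" for n
  proof (induction n)
    case 0
    show ?case using nn unfolding set_lebesgue_integral_def by (auto intro!: integral_nonneg_AE simp: indicator_def)
  next
    case (Suc n)
    have "{1..real n + 2} = {1..real n + 1} \<union> {real n + 1<..real n + 2}" by auto
    then have "(LINT t:{1..real n + 2}|lborel. h t) = (LINT t:{1..real n + 1}|lborel. h t) + (LINT t:{real n + 1<..real n + 2}|lborel. h t)"
      by (simp only:) (intro set_integral_Un sub, auto)
    then show ?case using Suc step[of n] by (simp add: add.commute)
  qed
  have "summable (\<lambda>k. h (real k + 2))"
  proof (rule summableI_nonneg_bounded)
    fix n
    have "(LINT t:{1..real n + 1}|lborel. h t) \<le> (LINT t:{1..}|lborel. h t)"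
      unfolding set_lebesgue_integral_def
      using sub[of "{1..real n + 1}"] int nn
      by (intro integral_mono) (auto simp: set_integrable_def indicator_def)
    then show "(\<Sum>k<n. h (real k + 2)) \<le> (LINT t:{1..}|lborel. h t)"
      using le[of n] by linarith
  qed (use nn in auto)
  then have "summable (\<lambda>k. h (real (k + 2)))" by (simp add: add.commute)
  then show ?thesis using summable_iff_shift[of "\<lambda>k. h (real k)" 2] by blast
qed

text \<open>Since \<phi>(t) / t is non-increasing, its value at |lat p| is at most its value at the
  smaller number \<open>sup_norm p\<close>. Injectivity follows from the separation
  condition.\<close>

lemma regular_seq_perturbed_lattice:
  assumes "regular_seq d \<gamma>"
  obtains a where "perturbed_lattice (\<lambda>p. of_real d * \<gamma> (fst p) (snd p)) a" "inj (\<lambda>p. \<gamma> (fst p) (snd p))"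
proof -
  obtain c \<phi> where c: "c > 0" and anti: "antimono_on {1..} (\<lambda>t. \<phi> t / t :: real)"
    and int: "set_integrable lborel {1..} (\<lambda>t. \<phi> t / t\<^sup>2)"
    and close: "\<And>m n. (m, n) \<noteq> (0, 0) \<Longrightarrow> cmod (lattice_pt m n - of_real d * \<gamma> m n) \<le> \<phi> (cmod (lattice_pt m n))"
    and sep: "\<And>m n m' n'. cmod (\<gamma> m n - \<gamma> m' n') \<ge> c * cmod (lattice_pt m n - lattice_pt m' n')"
    using assms unfolding regular_seq_def by (elim exE conjE) (rule that, assumption+, auto)
  \<comment> \<open>Non-negativity at integers comes from the lattice points on the positive real
    axis; monotonicity then carries it to all t \<ge> 1.\<close>
  have nat_nonneg: "\<phi> (real k) \<ge> 0" if "k \<ge> 1" for k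
  proof -
    have k: "cmod (lattice_pt (int k) 0) = real k"
      by (simp add: lattice_pt_def cmod_def)
    have "0 \<le> cmod (lattice_pt (int k) 0 - of_real d * \<gamma> (int k) 0)" by (rule norm_ge_zero)
    also have "\<dots> \<le> \<phi> (cmod (lattice_pt (int k) 0))" using that by (intro close) auto
    finally show ?thesis unfolding k .
  qed
  have nn: "\<phi> t / t \<ge> 0" if "t \<ge> 1" for t
  proof -
    have "real (nat \<lceil>t\<rceil>) \<ge> t" by (rule real_nat_ceiling_ge)
    then have "\<phi> (real (nat \<lceil>t\<rceil>)) / real (nat \<lceil>t\<rceil>) \<le> \<phi> t / t"
      using that by (intro monotone_onD[OF anti]) auto
    moreover have "\<phi> (real (nat \<lceil>t\<rceil>)) \<ge> 0"
      using that by (intro nat_nonneg) linarith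
    then have "\<phi> (real (nat \<lceil>t\<rceil>)) / real (nat \<lceil>t\<rceil>) \<ge> 0"
      by (rule divide_nonneg_nonneg) simp
    ultimately show ?thesis by (rule order_trans[rotated])
  qed
  have h: "\<phi> t / t\<^sup>2 = \<phi> t / t * (1 / t)" for t by (simp add: power2_eq_square)
  \<comment> \<open>The maximum with 1 keeps the argument where \<phi> is constrained, also for k =
    0.\<close>
  define a where "a k = \<phi> (max 1 (real k)) / max 1 (real k)" for k
  have "summable (\<lambda>k. \<phi> (real k) / (real k)\<^sup>2)"
  proof (rule summable_antimono_integrable[OF int])
    show "antimono_on {1..} (\<lambda>t. \<phi> t / t\<^sup>2)"
    proof (rule monotone_onI)
      fix x y :: real assume xy: "x \<in> {1..}" "y \<in> {1..}" "x \<le> y"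
      have "\<phi> y / y \<le> \<phi> x / x" by (rule monotone_onD[OF anti xy])
      then show "\<phi> y / y\<^sup>2 \<le> \<phi> x / x\<^sup>2"
        unfolding h using xy nn by (intro mult_mono) (auto simp: frac_le)
    qed
    show "0 \<le> \<phi> t / t\<^sup>2" if "t \<ge> 1" for t
      unfolding h using nn[OF that] that by (intro mult_nonneg_nonneg) auto
  qed
  moreover have "\<phi> (real k) / (real k)\<^sup>2 = a k / real k" for k
    by (cases "k = 0") (auto simp: a_def h max_def)
  ultimately have sm: "summable (\<lambda>k. a k / real k)" by simp
  have "perturbed_lattice (\<lambda>p. of_real d * \<gamma> (fst p) (snd p)) a"
  proof
    show "decseq a"
      unfolding decseq_def a_def by (intro allI impI monotone_onD[OF anti]) auto
    show "0 \<le> a k" for k unfolding a_def by (rule nn) simp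
    show "summable (\<lambda>k. a k / real k)" by (rule sm)
    fix p :: "int \<times> int" assume p: "p \<noteq> (0, 0)"
    then have "sup_norm p \<noteq> 0" by simp
    then have N: "real (sup_norm p) \<ge> 1" "real (sup_norm p) \<le> cmod (lat p)"
      using sup_norm_le_cmod_lat[of p] by linarith+
    have "cmod (lat p - of_real d * \<gamma> (fst p) (snd p)) \<le> \<phi> (cmod (lat p))"
      using close[of "fst p" "snd p"] p by (simp add: lat_def)
    also have "\<dots> = \<phi> (cmod (lat p)) / cmod (lat p) * cmod (lat p)"
      using N by auto
    also have "\<dots> \<le> a (sup_norm p) * cmod (lat p)"
      using N unfolding a_def by (intro mult_right_mono monotone_onD[OF anti]) auto
    finally show "cmod (lat p - of_real d * \<gamma> (fst p) (snd p)) \<le> a (sup_norm p) * cmod (lat p)" .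
  qed
  moreover have "inj (\<lambda>p. \<gamma> (fst p) (snd p))"
  proof (rule injI)
    fix p q :: "int \<times> int" assume "\<gamma> (fst p) (snd p) = \<gamma> (fst q) (snd q)"
    then have "c * cmod (lat p - lat q) \<le> 0"
      using sep[of "fst p" "snd p" "fst q" "snd q"] by (simp add: lat_def)
    then have "cmod (lat p - lat q) \<le> 0" using c by (simp add: mult_le_0_iff)
    then have "lat p = lat q" by simp
    then show "p = q" by (rule injD[OF inj_lat])
  qed
  ultimately show thesis using that by blast
qed

section \<open>Membership in the Fock space\<close>

lemma nn_integral_gaussian_finite:
  assumes "\<delta> > 0"
  shows "(\<integral>\<^sup>+x. ennreal (exp (- \<delta> * x\<^sup>2)) \<partial>lborel) < \<infinity>"
proof -
  define \<sigma> where "\<sigma> = 1 / sqrt (2 * \<delta>)"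
  have \<sigma>: "2 * \<sigma>\<^sup>2 = 1 / \<delta>" "\<sigma> > 0"
    using assms by (auto simp: \<sigma>_def power_divide)
  have eq: "exp (- \<delta> * x\<^sup>2) = sqrt (2 * pi * \<sigma>\<^sup>2) * normal_density 0 \<sigma> x" for x
    using \<sigma> by (simp add: normal_density_def mult.commute)
  have "integrable lborel (\<lambda>x. exp (- \<delta> * x\<^sup>2))"
    unfolding eq using \<sigma> by (intro integrable_mult_right integrable_normal_density)
  then show ?thesis
    by (auto dest!: integrableD(2) simp: less_top)
qed

lemma integrable_complex_gaussian:
  assumes "\<delta> > 0"
  shows "integrable lborel (\<lambda>z::complex. exp (- \<delta> * (cmod z)\<^sup>2))"
proof (rule integrableI_nonneg)
  let ?I = "\<integral>\<^sup>+x. ennreal (exp (- \<delta> * x\<^sup>2)) \<partial>lborel"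
  have "(\<integral>\<^sup>+z. ennreal (exp (- \<delta> * (cmod z)\<^sup>2)) \<partial>lborel) = (\<integral>\<^sup>+x. \<integral>\<^sup>+y. ennreal (exp (- \<delta> * (cmod (Complex x y))\<^sup>2)) \<partial>lborel \<partial>lborel)"
    by (rule nn_integral_complex_iterated) measurable
  also have "\<dots> = (\<integral>\<^sup>+x. \<integral>\<^sup>+y. ennreal (exp (- \<delta> * x\<^sup>2)) * ennreal (exp (- \<delta> * y\<^sup>2)) \<partial>lborel \<partial>lborel)"
    by (simp add: cmod_power2 algebra_simps flip: ennreal_mult exp_add)
  also have "\<dots> = ?I * ?I"
    by (simp add: nn_integral_cmult nn_integral_multc)
  also have "\<dots> < \<infinity>"
    using nn_integral_gaussian_finite[OF assms] by (simp add: ennreal_mult_less_top)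
  finally show "(\<integral>\<^sup>+z. ennreal (exp (- \<delta> * (cmod z)\<^sup>2)) \<partial>(lborel :: complex measure)) < \<infinity>" .
qed auto

text \<open>The gap pi - 2 \<beta> d^2 is positive: half of it absorbs the linear term in |z|, the
  other half leaves an integrable Gaussian.\<close>

lemma fock_spaceI:
  assumes F: "F holomorphic_on UNIV" and C: "C > 0" and d: "d > 0" and \<beta>: "2 * \<beta> * d\<^sup>2 < pi" "\<beta> > 0"
    and le: "\<And>z. cmod (F z) \<le> C * exp (\<beta> * (d * cmod z + 2)\<^sup>2)"
  shows "F \<in> fock_space"
proof -
  define \<delta> where "\<delta> = (pi - 2 * \<beta> * d\<^sup>2) / 2"
  have \<delta>: "\<delta> > 0" using \<beta> by (simp add: \<delta>_def)
  \<comment> \<open>The constant term 8 \<beta> plus (4 \<beta> d)^2 / \<delta> from completing the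
    square.\<close>
  define M where "M = 8 * \<beta> + 16 * \<beta>\<^sup>2 * d\<^sup>2 / \<delta>"
  have quad: "2 * \<beta> * (d * t + 2)\<^sup>2 - pi * t\<^sup>2 \<le> M - \<delta> * t\<^sup>2" for t
  proof -
    have "0 \<le> (\<delta> * t - 4 * \<beta> * d)\<^sup>2 / \<delta>" using \<delta> by simp
    also have "\<dots> = \<delta> * t\<^sup>2 - 8 * \<beta> * d * t + 16 * \<beta>\<^sup>2 * d\<^sup>2 / \<delta>"
      using \<delta> by (simp add: power2_eq_square field_simps)
    finally have "8 * \<beta> * d * t \<le> \<delta> * t\<^sup>2 + 16 * \<beta>\<^sup>2 * d\<^sup>2 / \<delta>" by simp
    moreover have "pi = 2 * \<delta> + 2 * \<beta> * d\<^sup>2" by (simp add: \<delta>_def field_simps)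
    then have "pi * t\<^sup>2 = (2 * \<delta> + 2 * \<beta> * d\<^sup>2) * t\<^sup>2" by (rule arg_cong)
    then have "2 * \<beta> * (d * t + 2)\<^sup>2 - pi * t\<^sup>2 = - (2 * \<delta> * t\<^sup>2) + 8 * \<beta> * d * t + 8 * \<beta>"
      by (simp add: power2_eq_square algebra_simps)
    ultimately show ?thesis unfolding M_def by linarith
  qed
  have "integrable lborel (\<lambda>z. (cmod (F z))\<^sup>2 * exp (- pi * (cmod z)\<^sup>2))"
  proof (rule Bochner_Integration.integrable_bound)
    show "integrable lborel (\<lambda>z::complex. (C\<^sup>2 * exp M) * exp (- \<delta> * (cmod z)\<^sup>2))"
      using integrable_complex_gaussian[OF \<delta>] by (rule integrable_mult_right)
    have "continuous_on UNIV F" using F by (rule holomorphic_on_imp_continuous_on)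
    then have [measurable]: "F \<in> borel_measurable borel" by (rule borel_measurable_continuous_onI)
    show "(\<lambda>z. (cmod (F z))\<^sup>2 * exp (- pi * (cmod z)\<^sup>2)) \<in> borel_measurable lborel" by measurable
    have "(cmod (F z))\<^sup>2 * exp (- pi * (cmod z)\<^sup>2) \<le> (C\<^sup>2 * exp M) * exp (- \<delta> * (cmod z)\<^sup>2)" for z
    proof -
      have "(cmod (F z))\<^sup>2 \<le> (C * exp (\<beta> * (d * cmod z + 2)\<^sup>2))\<^sup>2"
        using le by (intro power_mono) auto
      also have "\<dots> = C\<^sup>2 * exp (2 * \<beta> * (d * cmod z + 2)\<^sup>2)"
        by (simp add: power_mult_distrib exp_double [symmetric] mult.assoc)
      finally have "(cmod (F z))\<^sup>2 * exp (- pi * (cmod z)\<^sup>2) \<le> C\<^sup>2 * exp (2 * \<beta> * (d * cmod z + 2)\<^sup>2) * exp (- pi * (cmod z)\<^sup>2)"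
        by (rule mult_right_mono) simp
      also have "\<dots> = C\<^sup>2 * exp (2 * \<beta> * (d * cmod z + 2)\<^sup>2 - pi * (cmod z)\<^sup>2)"
        by (simp add: exp_diff exp_minus field_simps)
      also have "\<dots> \<le> C\<^sup>2 * exp (M - \<delta> * (cmod z)\<^sup>2)"
        using quad by (intro mult_left_mono) auto
      also have "\<dots> = (C\<^sup>2 * exp M) * exp (- \<delta> * (cmod z)\<^sup>2)"
        by (simp add: exp_diff exp_minus field_simps)
      finally show ?thesis .
    qed
    then show "AE z in lborel. norm ((cmod (F z))\<^sup>2 * exp (- pi * (cmod z)\<^sup>2)) \<le> norm ((C\<^sup>2 * exp M) * exp (- \<delta> * (cmod z)\<^sup>2))"
      using C by simp
  qed
  then show ?thesis using F by (simp add: fock_space_def)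
qed

section \<open>Uniqueness\<close>

text \<open>Three losses are kept small: s allows for the displacement of the zeros, \<rho> for the
  ratio of consecutive radii, and J for stopping after finitely many radii. The product tends to 1,
  hence can exceed \<kappa>.\<close>

lemma parameter_choice:
  fixes \<kappa> :: real
  assumes "0 < \<kappa>" "\<kappa> < 1"
  obtains \<rho> s :: real and J :: nat
  where "0 < \<rho>" "\<rho> < 1" "0 < s" "s < 1" "\<kappa> < s\<^sup>2 * (\<rho>\<^sup>2 * (1 - (\<rho>\<^sup>2) ^ J))"
proof -
  define \<rho> where "\<rho> = sqrt ((\<kappa> + 1) / 2)"
  have \<rho>2: "\<rho>\<^sup>2 = (\<kappa> + 1) / 2" using assms by (simp add: \<rho>_def)
  have \<rho>: "0 < \<rho>" "\<rho> < 1" using assms by (auto simp: \<rho>_def)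
  have "(\<lambda>J. \<rho>\<^sup>2 * (1 - (\<rho>\<^sup>2) ^ J)) \<longlonglongrightarrow> \<rho>\<^sup>2 * (1 - 0)"
    using assms by (intro tendsto_intros LIMSEQ_realpow_zero) (auto simp: \<rho>2)
  then have "eventually (\<lambda>J. \<kappa> < \<rho>\<^sup>2 * (1 - (\<rho>\<^sup>2) ^ J)) sequentially"
    by (rule order_tendstoD(1)) (use assms in \<open>simp add: \<rho>2\<close>)
  then obtain J where J: "\<kappa> < \<rho>\<^sup>2 * (1 - (\<rho>\<^sup>2) ^ J)"
    by (auto simp: eventually_sequentially)
  define Q where "Q = \<rho>\<^sup>2 * (1 - (\<rho>\<^sup>2) ^ J)"
  have Q: "\<kappa> < Q" "0 < Q" using J assms by (auto simp: Q_def)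
  define s where "s = sqrt ((\<kappa> / Q + 1) / 2)"
  have kq: "0 < \<kappa> / Q" "\<kappa> / Q < 1" using Q assms by auto
  have s2: "s\<^sup>2 = (\<kappa> / Q + 1) / 2" using kq by (simp add: s_def)
  have "0 < s" "s < 1" using kq by (auto simp: s_def)
  moreover have "\<kappa> / Q < s\<^sup>2" using kq s2 by simp
  then have "\<kappa> < s\<^sup>2 * Q" using Q by (simp add: pos_divide_less_eq)
  ultimately show thesis using that[of \<rho> s J] \<rho> by (simp add: Q_def)
qed

lemma sum_powers_from_1:
  fixes q :: real
  shows "(1 - q) * (\<Sum>j\<in>{1..J}. q ^ j) = q * (1 - q ^ J)"
proof (induction J)
  case (Suc J)
  have "(1 - q) * (\<Sum>j\<in>{1..Suc J}. q ^ j) = (1 - q) * (\<Sum>j\<in>{1..J}. q ^ j) + (1 - q) * q ^ Suc J"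
    by (simp add: distrib_left)
  also have "\<dots> = q * (1 - q ^ Suc J)"
    unfolding Suc by (simp add: algebra_simps)
  finally show ?case .
qed simp

lemma holomorphic_on_scaled_argument:
  assumes "f holomorphic_on UNIV"
  shows "(\<lambda>z. f (c * z)) holomorphic_on UNIV"
proof -
  have "(\<lambda>z. c * z) holomorphic_on UNIV" by (intro holomorphic_intros)
  from holomorphic_on_compose_gen[OF this assms] show ?thesis by (simp add: o_def)
qed

text \<open>Discrete integration of the counting function: a point that satisfies n of the
  conditions satisfies one with index at least n, so it gains at least n factors \<rho>. Exchanging
  the order of counting sums these gains over j.\<close>

lemma prod_le_power_count:
  fixes r :: "nat \<Rightarrow> real" and x :: "int \<times> int \<Rightarrow> real"
  assumes A: "finite A" and \<rho>: "0 < \<rho>" "\<rho> < 1" and R: "R > 0"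
    and x: "\<And>p. p \<in> A \<Longrightarrow> 0 \<le> x p" "\<And>p j. p \<in> A \<Longrightarrow> j \<in> {1..J} \<Longrightarrow> P p j \<Longrightarrow> x p \<le> R * \<rho> ^ j"
      "\<And>p. p \<in> A \<Longrightarrow> x p \<le> R"
  shows "(\<Prod>p\<in>A. x p) \<le> R ^ card A * \<rho> ^ (\<Sum>j\<in>{1..J}. card {p\<in>A. P p j})"
proof -
  define n where "n p = card {j\<in>{1..J}. P p j}" for p
  have "x p \<le> R * \<rho> ^ n p" if p: "p \<in> A" for p
  proof (cases "{j\<in>{1..J}. P p j} = {}")
    case True
    then show ?thesis using x(3)[OF p] by (simp add: n_def del: Collect_empty_eq)
  next
    case False
    define m where "m = Max {j\<in>{1..J}. P p j}"
    have fin: "finite {j\<in>{1..J}. P p j}" by simp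
    have m: "m \<in> {1..J}" "P p m" using Max_in[OF fin False] by (auto simp: m_def)
    have "{j\<in>{1..J}. P p j} \<subseteq> {1..m}" using Max_ge[OF fin] by (auto simp: m_def)
    then have "n p \<le> m" unfolding n_def using card_mono[of "{1..m}"] by fastforce
    then have "\<rho> ^ m \<le> \<rho> ^ n p" using \<rho> by (intro power_decreasing) auto
    then have "R * \<rho> ^ m \<le> R * \<rho> ^ n p" using R by simp
    then show ?thesis using x(2)[OF p m] by linarith
  qed
  then have "(\<Prod>p\<in>A. x p) \<le> (\<Prod>p\<in>A. R * \<rho> ^ n p)"
    using x(1) by (intro prod_mono) auto
  also have "\<dots> = R ^ card A * \<rho> ^ (\<Sum>p\<in>A. n p)"
    by (simp add: prod.distrib power_sum)
  also have "(\<Sum>p\<in>A. n p) = (\<Sum>j\<in>{1..J}. card {p\<in>A. P p j})"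
    unfolding n_def using A by (intro sum_multicount_gen) auto
  finally show ?thesis .
qed

section \<open>Zero counting against growth\<close>

context perturbed_lattice
begin

text \<open>At scale R^2 the zeros contribute pi / 2 times the quantity from
  \<open>parameter_choice\<close>, the growth bound only pi / 2 times \<kappa>; all other terms are
  at most linear in R.\<close>

lemma vanishing_if_small_growth:
  assumes inj: "inj g" and \<kappa>: "0 < \<kappa>" "\<kappa> < 1" and G: "G holomorphic_on UNIV" "\<And>p. G (g p) = 0"
    and C: "C > 0" "e \<ge> 0" "\<And>z. cmod (G z) \<le> C * exp (pi / 2 * \<kappa> * (cmod z + e)\<^sup>2)"
  shows "G z0 = 0"
proof (rule ccontr)
  assume z0: "G z0 \<noteq> 0"
  obtain \<rho> s J where \<rho>: "0 < \<rho>" "\<rho> < 1" and s: "0 < s" "s < 1"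
    and Q: "\<kappa> < s\<^sup>2 * (\<rho>\<^sup>2 * (1 - (\<rho>\<^sup>2) ^ J))"
    using parameter_choice[OF \<kappa>] by blast
  \<comment> \<open>Displacement below 1 / s - 1 gives |g p| \<le> |lat p| / s.\<close>
  have "1 / s - 1 > 0" using s by simp
  then have "\<exists>K\<ge>1. a K \<le> 1 / s - 1" by (rule small_tail) blast
  then obtain K where K: "K \<ge> 1" "a K \<le> 1 / s - 1" by blast
  have g_le: "cmod (g p) \<le> cmod (lat p) / s" if "sup_norm p \<ge> K" for p
  proof -
    have "cmod (g p) \<le> cmod (lat p) + cmod (lat p - g p)"
      using norm_triangle_sub[of "g p" "lat p"] by (simp add: norm_minus_commute)
    also have "cmod (lat p - g p) \<le> (1 / s - 1) * cmod (lat p)"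
      using close_tail(2,3)[OF K that] by (meson mult_right_mono norm_ge_zero order_trans)
    finally show ?thesis by (simp add: algebra_simps)
  qed
  define c where "c = cmod z0"
  have c: "c \<ge> 0" by (simp add: c_def)
  define c1 where "c1 = s * c + 1"
  have c1: "c1 \<ge> 0" using s c by (simp add: c1_def)
  define K' where "K' = real (card (lat_box K))"
  \<comment> \<open>Large enough that all radii t(0), ..., t(J) are at least 1, as the lattice count
    requires.\<close>
  define R0 where "R0 = (1 / s + c) / \<rho> ^ J + 1"
  have main: "pi / 2 * (s\<^sup>2 * (\<rho>\<^sup>2 * (1 - (\<rho>\<^sup>2) ^ J)) - \<kappa>) * R\<^sup>2
      \<le> (pi * \<kappa> * (c + e) + (1 - \<rho>) * (real J * (2 * pi * c1))) * R
        + (ln C - ln (cmod (G z0)) + pi / 2 * \<kappa> * (c + e)\<^sup>2 + (1 - \<rho>) * (real J * K'))" if R: "R \<ge> R0" for R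
  proof -
    have "R0 \<ge> 1" using s c \<rho> by (simp add: R0_def)
    then have R1: "R \<ge> 1" using R by linarith
    \<comment> \<open>Lattice points within t(j) have their g within R \<rho>^j of z0: divide by s
      and add the offset |z0|.\<close>
    define t where "t j = s * (R * \<rho> ^ j - c)" for j
    have t: "t j \<ge> 1" if "j \<le> J" for j
    proof -
      have "(1 / s + c) / \<rho> ^ J \<le> R" using R by (simp add: R0_def)
      then have "1 / s + c \<le> R * \<rho> ^ J" using \<rho> by (simp add: pos_divide_le_eq)
      also have "\<dots> \<le> R * \<rho> ^ j"
        using R1 \<rho> that by (intro mult_left_mono power_decreasing) auto
      finally have "1 / s \<le> R * \<rho> ^ j - c" by simp
      then show ?thesis using s by (simp add: t_def pos_divide_le_eq mult.commute)
    qed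
    \<comment> \<open>Discretized Jensen formula: zeros are counted in discs of radii \<open>R * \<rho> ^ j\<close>.\<close>
    define A where "A = {p. sup_norm p \<ge> K \<and> cmod (lat p) \<le> t 0}"
    have A: "finite A" using card_lat_disc_ge(1)[OF t[of 0]] by (auto simp: A_def intro: finite_subset[rotated])
    have dist: "cmod (g p - z0) \<le> R * \<rho> ^ j" if "p \<in> A" "cmod (lat p) \<le> t j" for p j
    proof -
      have "cmod (g p - z0) \<le> cmod (lat p) / s + c"
        using norm_triangle_ineq4[of "g p" z0] g_le[of p] that by (auto simp: A_def c_def)
      also have "cmod (lat p) / s \<le> R * \<rho> ^ j - c"
        using that s by (simp add: t_def pos_divide_le_eq mult.commute)
      finally show ?thesis by simp
    qed
    define S where "S = (\<Sum>j\<in>{1..J}. card {p\<in>A. cmod (lat p) \<le> t j})"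
    have S: "real S \<ge> (\<Sum>j\<in>{1..J}. pi * s\<^sup>2 * R\<^sup>2 * (\<rho>\<^sup>2) ^ j - (2 * pi * c1 * R + K'))"
      unfolding S_def of_nat_sum
    proof (rule sum_mono)
      fix j assume j: "j \<in> {1..J}"
      have tj: "t j \<ge> 1" using j by (intro t) auto
      have fin: "finite {p\<in>A. cmod (lat p) \<le> t j}" using A by simp
      have "t j \<le> t 0"
        unfolding t_def using s R1 \<rho> by (intro mult_left_mono) (auto simp: power_le_one)
      \<comment> \<open>\<open>A\<close> omits the indices below \<open>K\<close>; they change each
        count by at most the constant \<open>K'\<close>.\<close>
      then have "{p. cmod (lat p) \<le> t j} \<subseteq> {p\<in>A. cmod (lat p) \<le> t j} \<union> lat_box K"
        by (auto simp: A_def mem_lat_box)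
      then have "card {p. cmod (lat p) \<le> t j} \<le> card ({p\<in>A. cmod (lat p) \<le> t j} \<union> lat_box K)"
        using fin by (intro card_mono) auto
      also have "\<dots> \<le> card {p\<in>A. cmod (lat p) \<le> t j} + card (lat_box K)" by (rule card_Un_le)
      finally have "real (card {p. cmod (lat p) \<le> t j}) \<le> real (card {p\<in>A. cmod (lat p) \<le> t j}) + K'"
        unfolding K'_def by (simp flip: of_nat_add)
      moreover have "pi * (t j - 1)\<^sup>2 \<le> real (card {p. cmod (lat p) \<le> t j})"
        by (rule card_lat_disc_ge(2)[OF tj])
      moreover have "pi * s\<^sup>2 * R\<^sup>2 * (\<rho>\<^sup>2) ^ j - 2 * pi * c1 * R \<le> pi * (t j - 1)\<^sup>2"
      proof -
        define u where "u = s * \<rho> ^ j"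
        have u: "0 \<le> u" "u \<le> 1" using s \<rho> by (auto simp: u_def power_le_one intro!: mult_le_one)
        have "(u * R - c1)\<^sup>2 \<ge> u\<^sup>2 * R\<^sup>2 - 2 * c1 * (u * R)"
          by (simp add: power2_eq_square algebra_simps)
        moreover have "2 * c1 * (u * R) \<le> 2 * c1 * (1 * R)"
          using u c1 R1 by (intro mult_left_mono mult_right_mono) auto
        ultimately have "u\<^sup>2 * R\<^sup>2 - 2 * c1 * R \<le> (u * R - c1)\<^sup>2" by linarith
        then have "pi * (u\<^sup>2 * R\<^sup>2 - 2 * c1 * R) \<le> pi * (u * R - c1)\<^sup>2"
          by (intro mult_left_mono) auto
        moreover have e1: "u * R - c1 = t j - 1" by (simp add: u_def t_def c1_def algebra_simps)
        moreover have e2: "u\<^sup>2 = s\<^sup>2 * (\<rho>\<^sup>2) ^ j" by (simp add: u_def power_mult_distrib flip: power_mult) (simp add: mult.commute)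
        ultimately have "pi * (s\<^sup>2 * (\<rho>\<^sup>2) ^ j * R\<^sup>2 - 2 * c1 * R) \<le> pi * (t j - 1)\<^sup>2"
          by (simp only:)
        then show ?thesis by (simp add: algebra_simps)
      qed
      ultimately show "pi * s\<^sup>2 * R\<^sup>2 * (\<rho>\<^sup>2) ^ j - (2 * pi * c1 * R + K') \<le> real (card {p\<in>A. cmod (lat p) \<le> t j})"
        by linarith
    qed
    define B where "B = C * exp (pi / 2 * \<kappa> * (R + c + e)\<^sup>2)"
    have B0: "B > 0" using C by (simp add: B_def)
    have "cmod (G z0) * R ^ card (g ` A) \<le> B * (\<Prod>b\<in>g ` A. cmod (b - z0))"
    proof (rule jensen_inequality[OF G(1)])
      fix z assume "cmod (z - z0) = R"
      then have "cmod z \<le> R + c" using norm_triangle_sub[of z z0] by (simp add: c_def add.commute)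
      then have "(cmod z + e)\<^sup>2 \<le> (R + c + e)\<^sup>2" using C(2) by (intro power_mono) auto
      then have "exp (pi / 2 * \<kappa> * (cmod z + e)\<^sup>2) \<le> exp (pi / 2 * \<kappa> * (R + c + e)\<^sup>2)"
        using \<kappa> by simp
      then have "C * exp (pi / 2 * \<kappa> * (cmod z + e)\<^sup>2) \<le> B"
        unfolding B_def using C(1) by simp
      then show "cmod (G z) \<le> B" using C(3)[of z] by linarith
    qed (use A G R1 in auto)
    \<comment> \<open>Distinct points g make the number of zeros equal to the number of
      indices.\<close>
    moreover have injA: "inj_on g A" using inj by (rule inj_on_subset) simp
    ultimately have "cmod (G z0) * R ^ card A \<le> B * (\<Prod>p\<in>A. cmod (g p - z0))"
      by (simp add: card_image prod.reindex)
    also have "(\<Prod>p\<in>A. cmod (g p - z0)) \<le> R ^ card A * \<rho> ^ S"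
      unfolding S_def
    proof (rule prod_le_power_count[OF A \<rho>])
      show "cmod (g p - z0) \<le> R" if "p \<in> A" for p
        using dist[OF that, of 0] that by (simp add: A_def)
    qed (use R1 dist in auto)
    finally have "cmod (G z0) * R ^ card A \<le> (B * \<rho> ^ S) * R ^ card A"
      using B0 by (simp add: mult_ac)
    then have "cmod (G z0) \<le> B * \<rho> ^ S"
      using R1 by simp
    then have "ln (cmod (G z0)) \<le> ln (B * \<rho> ^ S)"
      using z0 B0 \<rho> by (subst ln_le_cancel_iff) auto
    also have "\<dots> = ln C + pi / 2 * \<kappa> * (R + c + e)\<^sup>2 + real S * ln \<rho>"
      using C B0 \<rho> by (simp add: ln_mult ln_realpow B_def)
    also have "real S * ln \<rho> \<le> real S * (- (1 - \<rho>))"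
      using ln_le_minus_one[OF \<rho>(1)] by (intro mult_left_mono) auto
    finally have 1: "(1 - \<rho>) * real S \<le> ln C - ln (cmod (G z0)) + pi / 2 * \<kappa> * (R + c + e)\<^sup>2"
      by (simp add: algebra_simps)
    \<comment> \<open>Since 1 - \<rho>^2 = (1 - \<rho>) (1 + \<rho>), the discretized integral of t
      keeps at least the factor 1/2 that the exact one has.\<close>
    have geo: "(1 - \<rho>) * (\<Sum>j\<in>{1..J}. (\<rho>\<^sup>2) ^ j) \<ge> \<rho>\<^sup>2 * (1 - (\<rho>\<^sup>2) ^ J) / 2"
    proof -
      have "(1 + \<rho>) * ((1 - \<rho>) * (\<Sum>j\<in>{1..J}. (\<rho>\<^sup>2) ^ j)) = (1 - \<rho>\<^sup>2) * (\<Sum>j\<in>{1..J}. (\<rho>\<^sup>2) ^ j)"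
        by (simp add: power2_eq_square algebra_simps)
      also have "\<dots> = \<rho>\<^sup>2 * (1 - (\<rho>\<^sup>2) ^ J)" by (rule sum_powers_from_1)
      finally have "(1 - \<rho>) * (\<Sum>j\<in>{1..J}. (\<rho>\<^sup>2) ^ j) = \<rho>\<^sup>2 * (1 - (\<rho>\<^sup>2) ^ J) / (1 + \<rho>)"
        using \<rho> by (simp add: eq_divide_eq mult.commute)
      moreover have "(\<rho>\<^sup>2) ^ J \<le> 1" using \<rho> by (intro power_le_one) (auto simp: power_le_one)
      ultimately show ?thesis
        using \<rho> by (simp only:) (intro divide_left_mono mult_nonneg_nonneg, auto)
    qed
    have "(1 - \<rho>) * (\<Sum>j\<in>{1..J}. pi * s\<^sup>2 * R\<^sup>2 * (\<rho>\<^sup>2) ^ j - (2 * pi * c1 * R + K')) \<le> (1 - \<rho>) * real S"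
      using S \<rho> by (intro mult_left_mono) auto
    moreover have "(1 - \<rho>) * (\<Sum>j\<in>{1..J}. pi * s\<^sup>2 * R\<^sup>2 * (\<rho>\<^sup>2) ^ j - (2 * pi * c1 * R + K'))
       = pi * s\<^sup>2 * R\<^sup>2 * ((1 - \<rho>) * (\<Sum>j\<in>{1..J}. (\<rho>\<^sup>2) ^ j)) - (1 - \<rho>) * (real J * (2 * pi * c1 * R + K'))"
      by (simp add: sum_subtractf sum_distrib_left [symmetric] algebra_simps del: sum.cl_ivl_Suc)
    moreover have "pi * s\<^sup>2 * R\<^sup>2 * (\<rho>\<^sup>2 * (1 - (\<rho>\<^sup>2) ^ J) / 2) \<le> pi * s\<^sup>2 * R\<^sup>2 * ((1 - \<rho>) * (\<Sum>j\<in>{1..J}. (\<rho>\<^sup>2) ^ j))"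
      using geo by (intro mult_left_mono) auto
    ultimately have "pi * s\<^sup>2 * R\<^sup>2 * (\<rho>\<^sup>2 * (1 - (\<rho>\<^sup>2) ^ J) / 2) - (1 - \<rho>) * (real J * (2 * pi * c1 * R + K'))
      \<le> ln C - ln (cmod (G z0)) + pi / 2 * \<kappa> * (R + c + e)\<^sup>2"
      using 1 by linarith
    moreover have "pi / 2 * \<kappa> * (R + c + e)\<^sup>2 = pi / 2 * \<kappa> * R\<^sup>2 + pi * \<kappa> * (c + e) * R + pi / 2 * \<kappa> * (c + e)\<^sup>2"
      by (simp add: power2_eq_square field_simps)
    ultimately show ?thesis by (simp add: field_simps)
  qed
  show False
    by (rule quadratic_not_le_affine[OF _ main]) (use Q in simp)
qed

end

theorem theorem1p2:
  fixes d :: real and \<gamma> :: "int \<Rightarrow> int \<Rightarrow> complex"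
  assumes "d > 0" and "regular_seq d \<gamma>"
  shows "(d < 1 \<longrightarrow> \<not> uniqueness_set {\<gamma> m n | m n. True} fock_space) \<and>
         (d > 1 \<longrightarrow> uniqueness_set {\<gamma> m n | m n. True} fock_space)"
proof -
  define g where "g p = of_real d * \<gamma> (fst p) (snd p)" for p
  obtain a where "perturbed_lattice g a" and inj\<gamma>: "inj (\<lambda>p. \<gamma> (fst p) (snd p))"
    using regular_seq_perturbed_lattice[OF assms(2)] unfolding g_def [abs_def] by blast
  then interpret perturbed_lattice g a by simp
  have set: "{\<gamma> m n | m n. True} = range (\<lambda>p. \<gamma> (fst p) (snd p))"
    by (auto simp: image_def)
  show ?thesis unfolding set
  proof (intro conjI impI)
    assume d: "d < 1"
    \<comment> \<open>Makes 2 (pi / 2 + e) d^2 the midpoint of pi d^2 and pi.\<close>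
    define e where "e = pi * (1 - d\<^sup>2) / (4 * d\<^sup>2)"
    have d2: "d\<^sup>2 < 1" using d assms(1) by (simp add: power_less_one_iff)
    have e: "e > 0" using d2 assms(1) by (simp add: e_def)
    have small: "2 * (pi / 2 + e) * d\<^sup>2 < pi"
    proof -
      have "2 * (pi / 2 + e) * d\<^sup>2 = pi * (1 + d\<^sup>2) / 2"
        using assms(1) by (simp add: e_def field_simps)
      moreover have "pi * (1 + d\<^sup>2) < pi * 2" using d2 by (intro mult_strict_left_mono) auto
      ultimately show ?thesis by linarith
    qed
    obtain P C z0 where P: "P holomorphic_on UNIV" "\<forall>p. P (g p) = 0" "P z0 \<noteq> 0" "C > 0"
      "\<forall>z. cmod (P z) \<le> C * exp ((pi / 2 + e) * (cmod z + 2)\<^sup>2)"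
      using interpolating_function[OF e] by blast
    define F where "F z = P (of_real d * z)" for z
    have "F holomorphic_on UNIV"
      unfolding F_def by (rule holomorphic_on_scaled_argument[OF P(1)])
    moreover have "cmod (F z) \<le> C * exp ((pi / 2 + e) * (d * cmod z + 2)\<^sup>2)" for z
      using P(5)[rule_format, of "of_real d * z"] assms(1) by (simp add: F_def norm_mult)
    ultimately have "F \<in> fock_space"
      using P(4) assms(1) small e by (intro fock_spaceI[where \<beta> = "pi / 2 + e"]) (auto intro: add_pos_pos)
    moreover have "\<forall>z\<in>range (\<lambda>p. \<gamma> (fst p) (snd p)). F z = 0"
      using P(2) by (auto simp: F_def g_def)
    moreover have "F (z0 / of_real d) \<noteq> 0"
      using P(3) assms(1) by (simp add: F_def)
    ultimately show "\<not> uniqueness_set (range (\<lambda>p. \<gamma> (fst p) (snd p))) fock_space"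
      unfolding uniqueness_set_def by blast
  next
    assume d: "d > 1"
    show "uniqueness_set (range (\<lambda>p. \<gamma> (fst p) (snd p))) fock_space"
      unfolding uniqueness_set_def
    proof (intro ballI impI allI)
      fix F z assume F: "F \<in> fock_space" and zero: "\<forall>z\<in>range (\<lambda>p. \<gamma> (fst p) (snd p)). F z = 0"
      obtain C where C: "C > 0" "\<And>z. cmod (F z) \<le> C * exp (pi / 2 * (cmod z + 3)\<^sup>2)"
        using fock_pointwise_bound[OF F] by blast
      define G where "G w = F (w / of_real d)" for w
      have "G (of_real d * z) = 0"
      \<comment> \<open>Rescaling by d divides the quadratic growth rate by d^2 and turns the offset
        3 into 3 d.\<close>
      proof (rule vanishing_if_small_growth[where G = G and \<kappa> = "1 / d\<^sup>2" and C = C and e = "3 * d"])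
        show "inj g"
          using inj\<gamma> assms(1) by (auto simp: g_def inj_def)
        show "0 < 1 / d\<^sup>2" "1 / d\<^sup>2 < 1" using d by (auto simp: one_less_power)
        have "F holomorphic_on UNIV" using F by (simp add: fock_space_def)
        then show "G holomorphic_on UNIV"
          using holomorphic_on_scaled_argument[of F "1 / of_real d"] by (simp add: G_def [abs_def])
        show "G (g p) = 0" for p
          using zero d by (simp add: G_def g_def)
        show "cmod (G w) \<le> C * exp (pi / 2 * (1 / d\<^sup>2) * (cmod w + 3 * d)\<^sup>2)" for w
        proof -
          have "(cmod w / d + 3)\<^sup>2 = (1 / d\<^sup>2) * (cmod w + 3 * d)\<^sup>2"
            using d by (simp add: power2_eq_square field_simps)
          then show ?thesis
            using C(2)[of "w / of_real d"] d by (simp add: G_def norm_divide mult.assoc)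
        qed
      qed (use C d in auto)
      then show "F z = 0" using d by (simp add: G_def)
    qed
  qed
qed

end
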